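(* Fix $N\ge 1$. For $M\ge N$ let $Y^{N,M}$ be a random matrix distributed as $\mathrm{LUE}(N,M)$, and let $X^N$ be a random matrix distributed as $\mathrm{GUE}(N)$. Then, as $M\to\infty$, $$\frac{Y^{N,M}-M\,\mathrm{Id}_N}{\sqrt{M}}\ \longrightarrow\ X^N\qquad\text{in distribution.}$$
   Context: $\mathcal{H}_N$ denotes the space of $N\times N$ Hermitian complex matrices, and $\mathrm{Id}_N$ the $N\times N$ identity matrix. Convergence in distribution is that of $\mathcal{H}_N$-valued random variables. $\mathrm{GUE}(N)$: the random matrix $X^N=(X_{i,j})_{1\le i,j\le N}\in\mathcal{H}_N$ where $(X_{i,j})_{1\le i<j\le N}$ are complex standard Gaussian variables, $(X_{i,i})_{1\le i\le N}$ are real standard Gaussian variables, all of these are independent, and $X_{i,j}=\overline{X_{j,i}}$ for $i>j$. Standard means $\mathbb{E}(X_{i,j})=0$ and $\mathbb{E}(|X_{i,j}|^2)=1$ (in the complex case, real and imaginary parts are independent centered Gaussians of variance $1/2$). Equivalently, its law on $\mathcal{H}_N$ has density proportional to $\exp(-\frac12\mathrm{Tr}(H^2))$ with respect to Lebesgue measure $dH$. $\mathrm{LUE}(N,M)$, for $M\ge N$: the random matrix $Y^{N,M}=A^{N,M}(A^{N,M})^{*}$ where $A^{N,M}$ is an $N\times M$ matrix whose entries are independent complex standard Gaussian variables and $*$ denotes conjugate transpose. Equivalently, its law on $\mathcal{H}_N$ has density proportional to $(\det H)^{M-N}\exp(-\mathrm{Tr}\,H)\mathbf{1}_{H\ge 0}$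 with respect to $dH$. *)

theory Defs
  imports "HOL-Probability.Probability"
begin

definition ctranspose :: "complex ^ 'n ^ 'm \<Rightarrow> complex ^ 'm ^ 'n" where
  "ctranspose A = (\<chi> i j. cnj (A $ j $ i))"

definition hermitian_matrices :: "(complex ^ 'n ^ 'n) set" where
  "hermitian_matrices = {H. ctranspose H = H}"

abbreviation hermitian_borel :: "(complex ^ 'n ^ 'n) measure" where
  "hermitian_borel \<equiv> restrict_space borel hermitian_matrices"

definition real_gaussian :: "real measure" where
  "real_gaussian = density lborel std_normal_density"

text \<open>The second parameter of \<^const>\<open>normal_density\<close> is the standard deviation: real and
  imaginary parts have variance 1/2.\<close>

definition complex_gaussian :: "complex measure" where
  "complex_gaussian =
     distr (density lborel (normal_density 0 (sqrt (1/2))) \<Otimes>\<^sub>M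
            density lborel (normal_density 0 (sqrt (1/2))))
       borel (\<lambda>(x, y). Complex x y)"

text \<open>\<open>N\<close> is \<open>CARD('n)\<close>. The linear order on the finite index type is the only structure of
  \<open>{1, \<dots>, N}\<close> that is used; it singles out the strictly upper triangular entries.\<close>

definition GUE_matrix ::
    "('n :: {finite, linorder} \<Rightarrow> real) \<times> ('n \<times> 'n \<Rightarrow> complex) \<Rightarrow> complex ^ ('n :: {finite, linorder}) ^ ('n :: {finite, linorder})" where
  "GUE_matrix = (\<lambda>(d, z). \<chi> i j.
     if i = j then of_real (d i) else if i < j then z (i, j) else cnj (z (j, i)))"

definition GUE :: "(complex ^ ('n :: {finite, linorder}) ^ ('n :: {finite, linorder})) measure" where
  "GUE = distr
     ((\<Pi>\<^sub>M i\<in>UNIV. real_gaussian) \<Otimes>\<^sub>M (\<Pi>\<^sub>M ij\<in>{(i, j). i < j}. complex_gaussian))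
     hermitian_borel GUE_matrix"

text \<open>As \<open>M\<close> varies while \<open>N\<close> is fixed, an \<open>N \<times> M\<close> matrix \<open>A\<close> is a function on
  \<open>UNIV \<times> {..<M}\<close>; the following is \<open>A A\<^sup>*\<close>.\<close>

definition gram_matrix :: "nat \<Rightarrow> ('n \<times> nat \<Rightarrow> complex) \<Rightarrow> complex ^ 'n ^ 'n" where
  "gram_matrix M A = (\<chi> i j. \<Sum>k<M. A (i, k) * cnj (A (j, k)))"

definition LUE :: "nat \<Rightarrow> (complex ^ 'n ^ 'n) measure" where
  "LUE M = distr (\<Pi>\<^sub>M ik\<in>UNIV \<times> {..<M}. complex_gaussian) hermitian_borel (gram_matrix M)"

text \<open>Convergence in distribution of \<open>S\<close>-valued random variables, each on its own probability
  space. It is meant for variables that are measurable into \<open>restrict_space borel S\<close>, so that the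
  integrals below are genuine expectations.\<close>

definition converges_in_distribution ::
    "'s::topological_space set \<Rightarrow> (nat \<Rightarrow> 'a measure) \<Rightarrow> (nat \<Rightarrow> 'a \<Rightarrow> 's) \<Rightarrow>
      'b measure \<Rightarrow> ('b \<Rightarrow> 's) \<Rightarrow> bool" where
  "converges_in_distribution S P Z Q X \<longleftrightarrow>
     (\<forall>f :: 's \<Rightarrow> real. continuous_on S f \<longrightarrow> bounded (f ` S) \<longrightarrow>
        (\<lambda>n. \<integral>\<omega>. f (Z n \<omega>) \<partial>P n) \<longlonglongrightarrow> (\<integral>\<omega>. f (X \<omega>) \<partial>Q))"

text \<open>\<^const>\<open>distr\<close> is only meaningful for measurable maps; this is checked here.\<close>

lemma sets_real_gaussian [measurable_cong]: "sets real_gaussian = sets borel"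
  by (simp add: real_gaussian_def)

lemma sets_complex_gaussian [measurable_cong]: "sets complex_gaussian = sets borel"
  by (simp add: complex_gaussian_def)

lemma prob_space_real_gaussian: "prob_space real_gaussian"
  unfolding real_gaussian_def by (rule prob_space_normal_density) simp

lemma borel_measurable_cnj: "cnj \<in> borel_measurable borel"
  by (intro borel_measurable_continuous_onI continuous_intros)

lemma measurable_Complex: "(\<lambda>(x, y). Complex x y) \<in> borel_measurable (borel \<Otimes>\<^sub>M borel)"
  unfolding Complex_eq case_prod_beta by measurable

lemma prob_space_complex_gaussian: "prob_space complex_gaussian"
proof -
  let ?D = "density lborel (normal_density 0 (sqrt (1/2)))"
  interpret D: prob_space ?D
    by (rule prob_space_normal_density) simp
  interpret DD: pair_prob_space ?D ?D ..
  have "(\<lambda>(x, y). Complex x y) \<in> borel_measurable (?D \<Otimes>\<^sub>M ?D)"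
    using measurable_Complex by (simp cong: measurable_cong_sets sets_pair_measure_cong)
  then show ?thesis
    unfolding complex_gaussian_def by (rule DD.prob_space_distr)
qed

lemma borel_measurable_vec:
  fixes f :: "'a \<Rightarrow> 'b::euclidean_space ^ 'n"
  assumes "\<And>i. (\<lambda>x. f x $ i) \<in> borel_measurable M"
  shows "f \<in> borel_measurable M"
proof (subst borel_measurable_euclidean_space, safe)
  fix b :: "'b ^ 'n" assume "b \<in> Basis"
  have "(\<lambda>x. \<Sum>i\<in>UNIV. f x $ i \<bullet> b $ i) \<in> borel_measurable M"
    using assms by measurable
  then show "(\<lambda>x. f x \<bullet> b) \<in> borel_measurable M"
    by (simp add: inner_vec_def)
qed

lemma borel_measurable_component:
  assumes "i \<in> I"
  shows "(\<lambda>A. A i) \<in> borel_measurable (\<Pi>\<^sub>M i\<in>I. complex_gaussian)"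
  using measurable_component_singleton[OF assms, of "\<lambda>_. complex_gaussian"]
  by (simp add: measurable_cong_sets[OF refl sets_complex_gaussian])

lemma measurable_GUE_matrix:
  "GUE_matrix \<in> (\<Pi>\<^sub>M i\<in>UNIV. real_gaussian) \<Otimes>\<^sub>M (\<Pi>\<^sub>M ij\<in>{(i, j). i < j}. complex_gaussian)
     \<rightarrow>\<^sub>M (hermitian_borel :: (complex ^ ('n :: {finite, linorder}) ^ ('n :: {finite, linorder})) measure)"
  (is "_ \<in> ?D \<rightarrow>\<^sub>M _")
proof (rule measurable_restrict_space2)
  show "GUE_matrix \<in> space ?D \<rightarrow> hermitian_matrices"
    by (auto simp: GUE_matrix_def hermitian_matrices_def ctranspose_def vec_eq_iff)
  have "(\<lambda>x. GUE_matrix x $ i $ j) \<in> borel_measurable ?D" for i j :: 'n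
  proof -
    consider "i = j" | "i < j" | "j < i" by fastforce
    then show ?thesis
    proof cases
      case 1
      have "(\<lambda>x. complex_of_real (fst x i)) \<in> borel_measurable ?D" by measurable
      with 1 show ?thesis by (simp add: GUE_matrix_def case_prod_beta)
    next
      case 2
      have "(\<lambda>x. snd x (i, j)) \<in> borel_measurable ?D"
        using 2 by (intro measurable_compose[OF measurable_snd borel_measurable_component]) simp
      with 2 show ?thesis by (simp add: GUE_matrix_def case_prod_beta less_imp_neq)
    next
      case 3
      have "(\<lambda>x. snd x (j, i)) \<in> borel_measurable ?D"
        using 3 by (intro measurable_compose[OF measurable_snd borel_measurable_component]) simp
      then have "(\<lambda>x. cnj (snd x (j, i))) \<in> borel_measurable ?D"
        by (rule measurable_compose[OF _ borel_measurable_cnj])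
      moreover have "i \<noteq> j" "\<not> i < j" using 3 by auto
      ultimately show ?thesis by (simp add: GUE_matrix_def case_prod_beta)
    qed
  qed
  then show "GUE_matrix \<in> borel_measurable ?D"
    by (intro borel_measurable_vec)
qed

lemma measurable_gram_matrix:
  "gram_matrix M \<in> (\<Pi>\<^sub>M ik\<in>UNIV \<times> {..<M}. complex_gaussian)
     \<rightarrow>\<^sub>M (hermitian_borel :: (complex ^ 'n ^ 'n) measure)"
  (is "_ \<in> ?D \<rightarrow>\<^sub>M _")
proof (rule measurable_restrict_space2)
  show "gram_matrix M \<in> space ?D \<rightarrow> hermitian_matrices"
    by (auto simp: gram_matrix_def hermitian_matrices_def ctranspose_def vec_eq_iff mult.commute)
  have 1: "(\<lambda>A. A (i, k)) \<in> borel_measurable ?D" if "k < M" for i :: 'n and k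
    using that by (intro borel_measurable_component) simp
  have 2: "(\<lambda>A. cnj (A (i, k))) \<in> borel_measurable ?D" if "k < M" for i :: 'n and k
    by (rule measurable_compose[OF 1[OF that] borel_measurable_cnj])
  show "gram_matrix M \<in> borel_measurable ?D"
    by (intro borel_measurable_vec)
      (auto simp: gram_matrix_def intro!: borel_measurable_sum borel_measurable_times 1 2)
qed

lemma prob_space_GUE: "prob_space (GUE :: (complex ^ ('n :: {finite, linorder}) ^ ('n :: {finite, linorder})) measure)"
proof -
  let ?R = "\<Pi>\<^sub>M i\<in>(UNIV :: 'n set). real_gaussian"
  let ?C = "\<Pi>\<^sub>M ij\<in>{(i :: 'n, j). i < j}. complex_gaussian"
  interpret R: prob_space ?R by (rule prob_space_PiM) (rule prob_space_real_gaussian)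
  interpret C: prob_space ?C by (rule prob_space_PiM) (rule prob_space_complex_gaussian)
  interpret RC: pair_prob_space ?R ?C ..
  show ?thesis
    unfolding GUE_def by (rule RC.prob_space_distr) (rule measurable_GUE_matrix)
qed

lemma prob_space_LUE: "prob_space (LUE M :: (complex ^ 'n ^ 'n) measure)"
  unfolding LUE_def
  by (intro prob_space.prob_space_distr prob_space_PiM prob_space_complex_gaussian
      measurable_gram_matrix)

end

theory Submission
  imports Defs
begin

text \<open>
  Write \<open>a\<^sub>k\<close> for the \<open>k\<close>-th column of the Gaussian matrix \<open>A\<close>. Then \<open>A A\<^sup>* - M Id\<close> is the sum over
  \<open>k < M\<close> of the independent, identically distributed, centred Hermitian matrices
  \<open>a\<^sub>k a\<^sub>k\<^sup>* - Id\<close>, so the theorem is a central limit theorem in the Euclidean space of Hermitian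
  matrices. Two things have to be checked: that one summand has the covariance of the GUE, and that
  convergence may be tested on linear forms.

  The covariance is a fourth moment of complex Gaussians. By Wick's formula
  (\<open>wick_complex_gaussian\<close>) the entries \<open>W\<^sub>i\<^sub>j\<close> of a summand satisfy
  \<open>E W\<^sub>i\<^sub>j W\<^sub>k\<^sub>l = \<delta>\<^sub>i\<^sub>l \<delta>\<^sub>j\<^sub>k\<close>, so a linear form \<open>\<langle>t, W\<rangle>\<close> has variance \<open>\<parallel>T\<parallel>\<^sup>2\<close>, where \<open>T\<close> is the
  Hermitian part of \<open>t\<close>. The GUE is the standard Gaussian on Hermitian matrices: its
  characteristic function at \<open>t\<close> is \<open>exp (- \<parallel>T\<parallel>\<^sup>2 / 2)\<close> (\<open>char_GUE\<close>). The one-dimensional central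
  limit theorem, applied to each \<open>\<langle>t, \<cdot>\<rangle>\<close>, then says that the characteristic functions of the
  normalised LUE converge pointwise to that of the GUE (\<open>char_LUE_tendsto\<close>).

  What remains is the continuity theorem for characteristic functions in several dimensions
  (\<open>levy_continuity_euclidean\<close>). Tightness is inherited from the one-dimensional marginals. On a
  cube, a bounded continuous function is uniformly approximated by trigonometric polynomials,
  whose integrals converge by hypothesis, and the approximants can be chosen with a global bound,
  so that tightness controls the error outside the cube.
\<close>

section \<open>Convergence of characteristic functions in Euclidean spaces\<close>

text \<open>The integral of such a function is a finite linear combination of values of the characteristic
  function of the measure.\<close>

inductive trig_polynomial :: "('a::real_inner \<Rightarrow> complex) \<Rightarrow> bool" where
  monomial: "trig_polynomial (\<lambda>x. c * iexp (t \<bullet> x))"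
| add: "trig_polynomial f \<Longrightarrow> trig_polynomial g \<Longrightarrow> trig_polynomial (\<lambda>x. f x + g x)"

lemma trig_polynomial_const: "trig_polynomial (\<lambda>x. c)"
  using trig_polynomial.monomial[of c 0] by simp

lemma trig_polynomial_monomial_mult:
  "trig_polynomial g \<Longrightarrow> trig_polynomial (\<lambda>x. c * iexp (t \<bullet> x) * g x)"
proof (induction rule: trig_polynomial.induct)
  case (monomial d s)
  have "(\<lambda>x. c * iexp (t \<bullet> x) * (d * iexp (s \<bullet> x))) = (\<lambda>x. (c * d) * iexp ((t + s) \<bullet> x))"
    by (simp add: fun_eq_iff inner_add_left distrib_left exp_add)
  then show ?case
    using trig_polynomial.monomial[of "c * d" "t + s"] by simp
next
  case (add f g)
  then show ?case
    using trig_polynomial.add by (simp add: distrib_left)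
qed

lemma trig_polynomial_mult:
  "trig_polynomial f \<Longrightarrow> trig_polynomial g \<Longrightarrow> trig_polynomial (\<lambda>x. f x * g x)"
proof (induction rule: trig_polynomial.induct)
  case (add f h)
  then show ?case
    using trig_polynomial.add by (simp add: distrib_right)
qed (rule trig_polynomial_monomial_mult)

lemma trig_polynomial_sum:
  "(\<And>i. i \<in> I \<Longrightarrow> trig_polynomial (f i)) \<Longrightarrow> trig_polynomial (\<lambda>x. \<Sum>i\<in>I. f i x)"
  by (induction I rule: infinite_finite_induct)
     (auto intro: trig_polynomial_const trig_polynomial.add)

lemma trig_polynomial_sin: "trig_polynomial (\<lambda>x. complex_of_real (sin (t \<bullet> x)))"
proof -
  have "complex_of_real (sin (t \<bullet> x)) = (1 / (2 * \<i>)) * iexp (t \<bullet> x) + (- 1 / (2 * \<i>)) * iexp ((- t) \<bullet> x)" for x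
    by (simp add: sin_of_real[symmetric] sin_exp_eq field_simps)
  moreover have "trig_polynomial (\<lambda>x. (1 / (2 * \<i>)) * iexp (t \<bullet> x) + (- 1 / (2 * \<i>)) * iexp ((- t) \<bullet> x))"
    by (intro trig_polynomial.intros)
  ultimately show ?thesis
    by presburger
qed

text \<open>Trigonometric polynomials form an algebra that contains the sines of the coordinates. Only the
  linear forms among the polynomials need an argument; sums and products come from the algebra.\<close>

lemma trig_polynomial_polynomial_of_sines:
  fixes p :: "'a::euclidean_space \<Rightarrow> real"
  assumes "real_polynomial_function p"
  shows "trig_polynomial (\<lambda>x. complex_of_real (p (\<Sum>b\<in>Basis. sin ((c *\<^sub>R b) \<bullet> x) *\<^sub>R b)))"
  using assms
proof (induction rule: real_polynomial_function.induct)
  case (linear f)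
  interpret f: bounded_linear f by fact
  have "trig_polynomial (\<lambda>x. \<Sum>b\<in>Basis. complex_of_real (sin ((c *\<^sub>R b) \<bullet> x)) * complex_of_real (f b))"
    by (intro trig_polynomial_sum trig_polynomial_mult trig_polynomial_sin trig_polynomial_const)
  then show ?case
    by (simp add: f.sum f.scaleR)
qed (auto intro: trig_polynomial_const trig_polynomial.add trig_polynomial_mult)

lemma trig_polynomial_bounded_continuous:
  assumes "trig_polynomial g"
  shows "continuous_on UNIV g \<and> bounded (range g)"
  using assms
proof (induction rule: trig_polynomial.induct)
  case (monomial c t)
  have "bounded (range (\<lambda>x. c * iexp (t \<bullet> x)))"
    by (rule boundedI[of _ "norm c"]) (auto simp: norm_mult)
  moreover have "continuous_on UNIV (\<lambda>x. c * iexp (t \<bullet> x))"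
    by (intro continuous_intros)
  ultimately show ?case by blast
next
  case (add f g)
  then show ?case
    by (auto intro: continuous_on_add bounded_plus_comp)
qed

lemma integrable_bounded_continuous:
  fixes f :: "'a::euclidean_space \<Rightarrow> 'b::euclidean_space"
  assumes "prob_space M" "sets M = sets borel" "continuous_on UNIV f" "bounded (range f)"
  shows "integrable M f"
proof -
  interpret prob_space M by fact
  obtain B where "\<And>x. norm (f x) \<le> B"
    using assms(4) by (auto simp: bounded_iff)
  moreover have "f \<in> borel_measurable M"
    using assms(2,3) borel_measurable_continuous_onI measurable_cong_sets by blast
  ultimately show ?thesis
    by (intro integrable_const_bound[of _ B]) auto
qed

lemma tendsto_integral_trig_polynomial:
  fixes \<mu> :: "nat \<Rightarrow> 'a::euclidean_space measure"
  assumes \<mu>: "\<And>n. prob_space (\<mu> n)" "\<And>n. sets (\<mu> n) = sets borel"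
    and \<nu>: "prob_space \<nu>" "sets \<nu> = sets borel"
    and char: "\<And>t. (\<lambda>n. \<integral>x. iexp (t \<bullet> x) \<partial>\<mu> n) \<longlonglongrightarrow> (\<integral>x. iexp (t \<bullet> x) \<partial>\<nu>)"
    and "trig_polynomial g"
  shows "(\<lambda>n. \<integral>x. g x \<partial>\<mu> n) \<longlonglongrightarrow> (\<integral>x. g x \<partial>\<nu>)"
  using assms(6)
proof (induction rule: trig_polynomial.induct)
  case (monomial c t)
  show ?case
    using tendsto_mult_left[OF char[of t], of c] by simp
next
  case (add f g)
  note bc = trig_polynomial_bounded_continuous[OF add.hyps(1)]
    trig_polynomial_bounded_continuous[OF add.hyps(2)]
  have "integrable (\<mu> n) f" "integrable (\<mu> n) g" "integrable \<nu> f" "integrable \<nu> g" for n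
    using bc by (auto intro!: integrable_bounded_continuous \<mu> \<nu>)
  then show ?case
    using tendsto_add[OF add.IH] by simp
qed

text \<open>The marginal in the direction \<open>b\<close> has characteristic function
  \<open>s \<mapsto> \<integral> exp (i \<langle>s b, x\<rangle>)\<close>, so the one-dimensional continuity theorem applies to it.\<close>

lemma tendsto_integral_coordinate:
  fixes \<mu> :: "nat \<Rightarrow> 'a::euclidean_space measure" and h :: "real \<Rightarrow> real"
  assumes \<mu>: "\<And>n. prob_space (\<mu> n)" "\<And>n. sets (\<mu> n) = sets borel"
    and \<nu>: "prob_space \<nu>" "sets \<nu> = sets borel"
    and char: "\<And>t. (\<lambda>n. \<integral>x. iexp (t \<bullet> x) \<partial>\<mu> n) \<longlonglongrightarrow> (\<integral>x. iexp (t \<bullet> x) \<partial>\<nu>)"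
    and h: "continuous_on UNIV h" "\<And>s. norm (h s) \<le> B"
  shows "(\<lambda>n. \<integral>x. h (b \<bullet> x) \<partial>\<mu> n) \<longlonglongrightarrow> (\<integral>x. h (b \<bullet> x) \<partial>\<nu>)"
proof -
  have m: "(\<lambda>x. b \<bullet> x) \<in> borel_measurable M" if "sets M = sets borel" for M :: "'a measure"
  proof -
    have "(\<lambda>x. b \<bullet> x) \<in> borel_measurable borel"
      by (intro borel_measurable_continuous_onI continuous_intros)
    then show ?thesis
      using measurable_cong_sets[OF that refl, of "borel :: real measure"] by simp
  qed
  have rd: "real_distribution (distr M borel (\<lambda>x. b \<bullet> x))"
    if "prob_space M" "sets M = sets borel" for M :: "'a measure"
    using that m by (intro prob_space.real_distribution_distr) auto
  have h_meas: "h \<in> borel_measurable borel"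
    using h(1) by (rule borel_measurable_continuous_onI)
  have char_eq: "char (distr M borel (\<lambda>x. b \<bullet> x)) s = (\<integral>x. iexp ((s *\<^sub>R b) \<bullet> x) \<partial>M)"
    if "sets M = sets borel" for M :: "'a measure" and s
    unfolding char_def by (subst integral_distr[OF m[OF that]]) auto
  have "weak_conv_m (\<lambda>n. distr (\<mu> n) borel (\<lambda>x. b \<bullet> x)) (distr \<nu> borel (\<lambda>x. b \<bullet> x))"
  proof (intro levy_continuity rd \<mu> \<nu>)
    show "(\<lambda>n. char (distr (\<mu> n) borel (\<lambda>x. b \<bullet> x)) s) \<longlonglongrightarrow> char (distr \<nu> borel (\<lambda>x. b \<bullet> x)) s" for s
      unfolding char_eq[OF \<mu>(2)] char_eq[OF \<nu>(2)] by (rule char)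
  qed
  from weak_conv_imp_integral_bdd_continuous_conv[OF rd[OF \<mu>] rd[OF \<nu>] this, of h B]
  show ?thesis
    using h h_meas by (simp add: integral_distr m \<mu> \<nu> continuous_on_eq_continuous_at)
qed

text \<open>Mass outside a cube is bounded by the integral of a continuous function that is a sum of functions
  of single coordinates. Such integrals converge, and for the limit measure they tend to 0 as the
  cube grows; hence one cube serves for the limit and for almost all members of the sequence.\<close>

lemma tight_of_char_convergence:
  fixes \<mu> :: "nat \<Rightarrow> 'a::euclidean_space measure"
  assumes \<mu>: "\<And>n. prob_space (\<mu> n)" "\<And>n. sets (\<mu> n) = sets borel"
    and \<nu>: "prob_space \<nu>" "sets \<nu> = sets borel"
    and char: "\<And>t. (\<lambda>n. \<integral>x. iexp (t \<bullet> x) \<partial>\<mu> n) \<longlonglongrightarrow> (\<integral>x. iexp (t \<bullet> x) \<partial>\<nu>)"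
    and "0 < \<delta>"
  obtains R where "0 < R" "measure \<nu> {x. \<exists>b\<in>Basis. R < \<bar>b \<bullet> x\<bar>} < \<delta>"
    "\<forall>\<^sub>F n in sequentially. measure (\<mu> n) {x. \<exists>b\<in>Basis. R < \<bar>b \<bullet> x\<bar>} < \<delta>"
proof -
  \<comment> \<open>A continuous majorant of the indicator of \<open>k + 1 < \<bar>s\<bar>\<close> that vanishes for \<open>\<bar>s\<bar> \<le> k\<close>.\<close>
  define h :: "nat \<Rightarrow> real \<Rightarrow> real" where "h k s = min 1 (max 0 (\<bar>s\<bar> - real k))" for k s
  define H :: "nat \<Rightarrow> 'a \<Rightarrow> real" where "H k x = (\<Sum>b\<in>Basis. h k (b \<bullet> x))" for k x
  have h_bd: "0 \<le> h k s" "norm (h k s) \<le> 1" for k s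
    by (auto simp: h_def)
  have h_cont: "continuous_on UNIV (h k)" for k
    unfolding h_def by (intro continuous_intros)
  have h_inner_cont: "continuous_on UNIV (\<lambda>x::'a. h k (b \<bullet> x))" for k b
    unfolding h_def by (intro continuous_intros)
  have h_inner_bd: "bounded (range (\<lambda>x::'a. h k (b \<bullet> x)))" for k b
    by (rule boundedI[of _ 1]) (use h_bd in auto)
  note h_int = integrable_bounded_continuous[OF _ _ h_inner_cont h_inner_bd]
  have H_int: "integrable M (H k)" and H_eq: "integral\<^sup>L M (H k) = (\<Sum>b\<in>Basis. \<integral>x. h k (b \<bullet> x) \<partial>M)"
    if "prob_space M" "sets M = sets borel" for M k
    unfolding H_def using h_int[OF that] by auto
  have tail: "measure M {x. \<exists>b\<in>Basis. real k + 1 < \<bar>b \<bullet> x\<bar>} \<le> integral\<^sup>L M (H k)"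
    (is "measure M ?A \<le> _")
    if M: "prob_space M" "sets M = sets borel" for M k
  proof -
    interpret prob_space M by fact
    have "?A = (\<Union>b\<in>Basis. {x. real k + 1 < \<bar>b \<bullet> x\<bar>})" by auto
    moreover have "open {x::'a. real k + 1 < \<bar>b \<bullet> x\<bar>}" for b
      by (intro open_Collect_less continuous_intros)
    ultimately have A: "?A \<in> sets M"
      using M(2) by auto
    have "measure M ?A = integral\<^sup>L M (indicator ?A)"
      using A by simp
    also have "\<dots> \<le> integral\<^sup>L M (H k)"
    proof (rule integral_mono)
      show "indicator ?A x \<le> H k x" for x
      proof (cases "x \<in> ?A")
        case True
        then obtain b where "b \<in> Basis" "real k + 1 < \<bar>b \<bullet> x\<bar>" by auto
        then have "1 \<le> h k (b \<bullet> x)" by (simp add: h_def)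
        also have "\<dots> \<le> H k x"
          unfolding H_def using \<open>b \<in> Basis\<close> h_bd(1) by (intro member_le_sum) auto
        finally show ?thesis using True by simp
      next
        case False
        then show ?thesis by (simp add: H_def h_bd(1) sum_nonneg)
      qed
    qed (use A M H_int in \<open>auto simp: integrable_indicator_iff emeasure_eq_measure\<close>)
    finally show ?thesis .
  qed
  interpret \<nu>: prob_space \<nu> by fact
  have "(\<lambda>k. \<integral>x. h k (b \<bullet> x) \<partial>\<nu>) \<longlonglongrightarrow> (\<integral>x. 0 \<partial>\<nu>)" for b
  proof (rule integral_dominated_convergence[where w = "\<lambda>_. 1"])
    have "h k s = 0" if "nat \<lceil>\<bar>s\<bar>\<rceil> \<le> k" for k s
      using that by (simp add: h_def nat_ceiling_le_eq)
    then have "(\<lambda>k. h k s) \<longlonglongrightarrow> 0" for s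
      by (intro tendsto_eventually eventually_sequentiallyI[of "nat \<lceil>\<bar>s\<bar>\<rceil>"])
    then show "AE x in \<nu>. (\<lambda>k. h k (b \<bullet> x)) \<longlonglongrightarrow> 0" by simp
  qed (use h_bd h_int[OF \<nu>] in auto)
  then have "(\<lambda>k. integral\<^sup>L \<nu> (H k)) \<longlonglongrightarrow> (\<Sum>b\<in>(Basis :: 'a set). \<integral>x. 0 \<partial>\<nu>)"
    unfolding H_eq[OF \<nu>] by (intro tendsto_sum)
  then have "\<forall>\<^sub>F k in sequentially. integral\<^sup>L \<nu> (H k) < \<delta>"
    using \<open>0 < \<delta>\<close> by (auto dest!: order_tendstoD(2)[of _ _ _ \<delta>])
  then obtain k where k: "integral\<^sup>L \<nu> (H k) < \<delta>"
    by (auto simp: eventually_sequentially)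
  have "(\<lambda>n. integral\<^sup>L (\<mu> n) (H k)) \<longlonglongrightarrow> integral\<^sup>L \<nu> (H k)"
    unfolding H_eq[OF \<nu>] H_eq[OF \<mu>]
    by (intro tendsto_sum tendsto_integral_coordinate[OF \<mu> \<nu> char h_cont h_bd(2)])
  then have "\<forall>\<^sub>F n in sequentially. integral\<^sup>L (\<mu> n) (H k) < \<delta>"
    using k by (rule order_tendstoD)
  then have "\<forall>\<^sub>F n in sequentially. measure (\<mu> n) {x. \<exists>b\<in>Basis. real k + 1 < \<bar>b \<bullet> x\<bar>} < \<delta>"
    by eventually_elim (use tail[OF \<mu>] le_less_trans in blast)
  then show thesis
    using that[of "real k + 1"] le_less_trans[OF tail[OF \<nu>] k] by simp
qed

text \<open>The map \<open>\<theta>\<close> that takes \<open>sin (\<pi> x\<^sub>b / (2 R))\<close> in each coordinate is a homeomorphism from the cube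
  \<open>[-R, R]\<^sup>d\<close> onto \<open>[-1, 1]\<^sup>d\<close>, with inverse \<open>\<eta>\<close>. If a polynomial \<open>p\<close> approximates \<open>f \<circ> \<eta>\<close> on
  \<open>[-1, 1]\<^sup>d\<close>, then \<open>p \<circ> \<theta>\<close> is a trigonometric polynomial that approximates \<open>f\<close> on the cube.
  Because \<open>\<theta>\<close> maps the whole space into \<open>[-1, 1]\<^sup>d\<close>, the bound of \<open>f\<close> is inherited everywhere and
  not only on the cube.\<close>

lemma trig_polynomial_approximation_on_cube:
  fixes f :: "'a::euclidean_space \<Rightarrow> real"
  assumes f: "continuous_on UNIV f" "\<And>x. \<bar>f x\<bar> \<le> B" and "0 < R" "0 < \<epsilon>"
  obtains g where "trig_polynomial (\<lambda>x. complex_of_real (g x))" "\<And>x. \<bar>g x\<bar> \<le> B + \<epsilon>"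
    "\<And>x. (\<And>b. b \<in> Basis \<Longrightarrow> \<bar>b \<bullet> x\<bar> \<le> R) \<Longrightarrow> \<bar>f x - g x\<bar> \<le> \<epsilon>"
proof -
  define c where "c = pi / (2 * R)"
  define \<theta> where "\<theta> x = (\<Sum>b\<in>Basis. sin ((c *\<^sub>R b) \<bullet> x) *\<^sub>R b)" for x :: 'a
  define \<eta> where "\<eta> u = (\<Sum>b\<in>Basis. (arcsin (b \<bullet> u) / c) *\<^sub>R b)" for u :: 'a
  have "c > 0" using \<open>0 < R\<close> by (simp add: c_def)
  let ?K = "cbox (- One) One :: 'a set"
  have K: "\<bar>b \<bullet> u\<bar> \<le> 1" if "u \<in> ?K" "b \<in> Basis" for u b
    using that by (auto simp: mem_box inner_commute[of b] abs_le_iff)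
  have "continuous_on ?K (\<lambda>u. f (\<eta> u))"
  proof (rule continuous_on_compose2[OF f(1)])
    have "- 1 \<le> b \<bullet> u \<and> b \<bullet> u \<le> 1" if "u \<in> ?K" "b \<in> Basis" for u b
      using K[OF that] by linarith
    then show "continuous_on ?K \<eta>"
      unfolding \<eta>_def using \<open>c > 0\<close> by (intro continuous_intros) auto
  qed simp
  from Stone_Weierstrass_real_polynomial_function[OF compact_cbox this \<open>0 < \<epsilon>\<close>]
  obtain p where p: "real_polynomial_function p" "\<And>u. u \<in> ?K \<Longrightarrow> \<bar>f (\<eta> u) - p u\<bar> < \<epsilon>"
    by blast
  have \<theta>_K: "\<theta> x \<in> ?K" for x
    unfolding mem_box \<theta>_def by (auto simp: inner_sum_left_Basis)
  have \<eta>_\<theta>: "\<eta> (\<theta> x) = x" if x: "\<And>b. b \<in> Basis \<Longrightarrow> \<bar>b \<bullet> x\<bar> \<le> R" for x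
  proof (rule euclidean_eqI)
    fix b :: 'a assume b: "b \<in> Basis"
    have "\<bar>c * (b \<bullet> x)\<bar> \<le> c * R"
      using x[OF b] \<open>c > 0\<close> by (simp add: abs_mult)
    also have "c * R = pi / 2"
      using \<open>0 < R\<close> by (simp add: c_def)
    finally have "arcsin (sin (c * (b \<bullet> x))) = c * (b \<bullet> x)"
      by (intro arcsin_sin) auto
    moreover have "b \<bullet> \<theta> x = sin (c * (b \<bullet> x))"
      using b by (simp add: \<theta>_def inner_commute[of b] inner_sum_left_Basis)
    moreover have "\<eta> (\<theta> x) \<bullet> b = arcsin (b \<bullet> \<theta> x) / c"
      unfolding \<eta>_def using b by (rule inner_sum_left_Basis)
    ultimately show "\<eta> (\<theta> x) \<bullet> b = x \<bullet> b"
      using \<open>c > 0\<close> by (simp add: inner_commute)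
  qed
  show thesis
  proof (rule that)
    show "trig_polynomial (\<lambda>x. complex_of_real (p (\<theta> x)))"
      unfolding \<theta>_def by (rule trig_polynomial_polynomial_of_sines) (rule p(1))
    show "\<bar>p (\<theta> x)\<bar> \<le> B + \<epsilon>" for x
      using p(2)[OF \<theta>_K, of x] f(2)[of "\<eta> (\<theta> x)"] by linarith
    show "\<bar>f x - p (\<theta> x)\<bar> \<le> \<epsilon>" if "\<And>b. b \<in> Basis \<Longrightarrow> \<bar>b \<bullet> x\<bar> \<le> R" for x
      using p(2)[OF \<theta>_K, of x] \<eta>_\<theta>[OF that] by simp
  qed
qed

text \<open>Replace \<open>f\<close> by a trigonometric polynomial \<open>g\<close>: on a large cube they are uniformly close, and off
  the cube \<open>\<bar>f - g\<bar> \<le> 2 B + \<epsilon>\<close> on a set of small mass, uniformly along the sequence.\<close>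

theorem levy_continuity_euclidean:
  fixes \<mu> :: "nat \<Rightarrow> 'a::euclidean_space measure" and f :: "'a \<Rightarrow> real"
  assumes \<mu>: "\<And>n. prob_space (\<mu> n)" "\<And>n. sets (\<mu> n) = sets borel"
    and \<nu>: "prob_space \<nu>" "sets \<nu> = sets borel"
    and char: "\<And>t. (\<lambda>n. \<integral>x. iexp (t \<bullet> x) \<partial>\<mu> n) \<longlonglongrightarrow> (\<integral>x. iexp (t \<bullet> x) \<partial>\<nu>)"
    and f: "continuous_on UNIV f" "bounded (range f)"
  shows "(\<lambda>n. \<integral>x. f x \<partial>\<mu> n) \<longlonglongrightarrow> (\<integral>x. f x \<partial>\<nu>)"
proof (rule tendstoI)
  fix \<epsilon> :: real assume "0 < \<epsilon>"
  obtain B where B: "\<And>x. \<bar>f x\<bar> \<le> B" "0 < B"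
    using f(2) by (auto simp: bounded_pos)
  \<comment> \<open>Replacing \<open>f\<close> by \<open>g\<close> costs at most \<open>2 e\<close> for each of two measures, and the integrals of \<open>g\<close>
    differ by less than \<open>e\<close>; \<open>\<delta>\<close> makes the mass off the cube contribute at most \<open>e\<close>.\<close>
  define e where "e = \<epsilon> / 5"
  have e: "0 < e" using \<open>0 < \<epsilon>\<close> by (simp add: e_def)
  define \<delta> where "\<delta> = e / (2 * B + e)"
  have \<delta>: "0 < \<delta>" "(2 * B + e) * \<delta> = e" using e B(2) by (auto simp: \<delta>_def)
  obtain R where R: "0 < R" "measure \<nu> {x. \<exists>b\<in>Basis. R < \<bar>b \<bullet> x\<bar>} < \<delta>"
    "\<forall>\<^sub>F n in sequentially. measure (\<mu> n) {x. \<exists>b\<in>Basis. R < \<bar>b \<bullet> x\<bar>} < \<delta>"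
    using tight_of_char_convergence[OF \<mu> \<nu> char \<delta>(1)] by blast
  obtain g where g: "trig_polynomial (\<lambda>x. complex_of_real (g x))" "\<And>x. \<bar>g x\<bar> \<le> B + e"
    "\<And>x. (\<And>b. b \<in> Basis \<Longrightarrow> \<bar>b \<bullet> x\<bar> \<le> R) \<Longrightarrow> \<bar>f x - g x\<bar> \<le> e"
    using trig_polynomial_approximation_on_cube[OF f(1) B(1) R(1) e] by blast
  let ?A = "{x::'a. \<exists>b\<in>Basis. R < \<bar>b \<bullet> x\<bar>}"
  have g_cont: "continuous_on UNIV g"
    using continuous_on_Re trig_polynomial_bounded_continuous[OF g(1)] by fastforce
  have g_bd: "bounded (range g)"
    by (rule boundedI[of _ "B + e"]) (use g(2) in auto)
  have close: "\<bar>integral\<^sup>L M f - integral\<^sup>L M g\<bar> \<le> 2 * e"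
    if M: "prob_space M" "sets M = sets borel" and small: "measure M ?A < \<delta>" for M
  proof -
    interpret prob_space M by fact
    have "?A = (\<Union>b\<in>Basis. {x. R < \<bar>b \<bullet> x\<bar>})" by auto
    moreover have "open {x::'a. R < \<bar>b \<bullet> x\<bar>}" for b
      by (intro open_Collect_less continuous_intros)
    ultimately have A: "?A \<in> sets M"
      using M(2) by auto
    have int: "integrable M f" "integrable M g"
      using f g_cont g_bd by (auto intro: integrable_bounded_continuous[OF M])
    have ind: "integrable M (indicator ?A :: 'a \<Rightarrow> real)"
      using A by (simp add: integrable_indicator_iff emeasure_eq_measure)
    have pointwise: "\<bar>f x - g x\<bar> \<le> e + (2 * B + e) * indicator ?A x" for x
    proof (cases "x \<in> ?A")
      case True
      then show ?thesis using B(1)[of x] g(2)[of x] e by (simp split: if_splits)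
    next
      case False
      then show ?thesis using g(3)[of x] by (simp add: not_less)
    qed
    have "\<bar>integral\<^sup>L M f - integral\<^sup>L M g\<bar> = \<bar>\<integral>x. f x - g x \<partial>M\<bar>"
      using int by simp
    also have "\<dots> \<le> (\<integral>x. \<bar>f x - g x\<bar> \<partial>M)"
      by (rule integral_abs_bound)
    also have "\<dots> \<le> (\<integral>x. e + (2 * B + e) * indicator ?A x \<partial>M)"
      using int ind by (intro integral_mono pointwise) auto
    also have "\<dots> = e + (2 * B + e) * measure M ?A"
      using ind A by (simp add: prob_space)
    also have "\<dots> \<le> e + (2 * B + e) * \<delta>"
      using small e B(2) by simp
    finally show ?thesis using \<delta>(2) by simp
  qed
  have "(\<lambda>n. \<integral>x. g x \<partial>\<mu> n) \<longlonglongrightarrow> (\<integral>x. g x \<partial>\<nu>)"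
    using tendsto_Re[OF tendsto_integral_trig_polynomial[OF \<mu> \<nu> char g(1)]] by simp
  then have "\<forall>\<^sub>F n in sequentially. dist (\<integral>x. g x \<partial>\<mu> n) (\<integral>x. g x \<partial>\<nu>) < e"
    using e by (rule tendstoD)
  with R(3) show "\<forall>\<^sub>F n in sequentially. dist (\<integral>x. f x \<partial>\<mu> n) (\<integral>x. f x \<partial>\<nu>) < \<epsilon>"
  proof eventually_elim
    case (elim n)
    with close[OF \<mu> elim(1)] close[OF \<nu> R(2)] show ?case
      unfolding dist_real_def e_def by linarith
  qed
qed

section \<open>Moments of complex Gaussian variables\<close>

lemma (in pair_sigma_finite)
  fixes f :: "'a \<Rightarrow> 'c::{real_normed_field, banach, second_countable_topology}"
  assumes f: "integrable M1 f" and g: "integrable M2 g"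
  shows integrable_pair_mult: "integrable (M1 \<Otimes>\<^sub>M M2) (\<lambda>x. f (fst x) * g (snd x))"
    and integral_pair_mult:
      "(\<integral>x. f (fst x) * g (snd x) \<partial>(M1 \<Otimes>\<^sub>M M2)) = integral\<^sup>L M1 f * integral\<^sup>L M2 g"
proof -
  have [measurable]: "f \<in> borel_measurable M1" "g \<in> borel_measurable M2"
    using f g by auto
  show int: "integrable (M1 \<Otimes>\<^sub>M M2) (\<lambda>x. f (fst x) * g (snd x))"
    by (rule Fubini_integrable) (use f g in \<open>auto simp: norm_mult\<close>)
  show "(\<integral>x. f (fst x) * g (snd x) \<partial>(M1 \<Otimes>\<^sub>M M2)) = integral\<^sup>L M1 f * integral\<^sup>L M2 g"
    using integral_fst'[OF int] by simp
qed

interpretation std_normal: real_distribution std_normal_distribution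
  by (rule real_dist_normal_dist)

interpretation std_normal_pair: pair_prob_space std_normal_distribution std_normal_distribution ..

lemma normal_eq_scaled_std_normal:
  assumes "0 < \<sigma>"
  shows "density lborel (normal_density 0 \<sigma>) = distr std_normal_distribution borel (\<lambda>x. \<sigma> * x)"
proof -
  have "distributed std_normal_distribution lborel (\<lambda>x. x) std_normal_density"
    by (auto simp: distributed_def intro!: distr_id2)
  from std_normal.normal_density_affine[OF this, of \<sigma> 0] assms
  have "distributed std_normal_distribution lborel (\<lambda>x. \<sigma> * x) (normal_density 0 \<sigma>)"
    by simp
  then have "density lborel (normal_density 0 \<sigma>) = distr std_normal_distribution lborel (\<lambda>x. \<sigma> * x)"
    by (simp add: distributed_def)
  also have "\<dots> = distr std_normal_distribution borel (\<lambda>x. \<sigma> * x)"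
    by (intro distr_cong) auto
  finally show ?thesis .
qed

lemma std_normal_eq_reflected: "distr std_normal_distribution borel uminus = std_normal_distribution"
proof -
  have "distributed std_normal_distribution lborel (\<lambda>x. x) std_normal_density"
    by (auto simp: distributed_def intro!: distr_id2)
  from std_normal.normal_density_affine[OF this, of "-1" 0]
  have "distributed std_normal_distribution lborel uminus std_normal_density"
    by simp
  then have "std_normal_distribution = distr std_normal_distribution lborel uminus"
    by (simp add: distributed_def)
  also have "\<dots> = distr std_normal_distribution borel uminus"
    by (intro distr_cong) auto
  finally show ?thesis by simp
qed

text \<open>A complex Gaussian as the image of two independent standard normals, whose moments are known.\<close>

definition complex_of_normals :: "real \<times> real \<Rightarrow> complex" where
  "complex_of_normals x = Complex (sqrt (1/2) * fst x) (sqrt (1/2) * snd x)"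

lemma measurable_complex_of_normals [measurable]:
  "complex_of_normals \<in> borel_measurable (std_normal_distribution \<Otimes>\<^sub>M std_normal_distribution)"
  unfolding complex_of_normals_def Complex_eq by measurable

lemma complex_gaussian_eq:
  "complex_gaussian = distr (std_normal_distribution \<Otimes>\<^sub>M std_normal_distribution) borel complex_of_normals"
proof -
  let ?N = std_normal_distribution and ?s = "sqrt (1/2) :: real"
  have "complex_gaussian =
    distr (distr ?N borel (\<lambda>x. ?s * x) \<Otimes>\<^sub>M distr ?N borel (\<lambda>x. ?s * x)) borel (\<lambda>(x, y). Complex x y)"
    unfolding complex_gaussian_def by (subst (1 2) normal_eq_scaled_std_normal) simp_all
  also have "\<dots> = distr (distr (?N \<Otimes>\<^sub>M ?N) (borel \<Otimes>\<^sub>M borel) (\<lambda>(x, y). (?s * x, ?s * y))) borel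
      (\<lambda>(x, y). Complex x y)"
    by (subst pair_measure_distr)
       (simp_all add: prob_space_imp_sigma_finite std_normal.prob_space_distr)
  also have "\<dots> = distr (?N \<Otimes>\<^sub>M ?N) borel complex_of_normals"
    using measurable_Complex
    by (subst distr_distr) (auto simp: complex_of_normals_def[abs_def] comp_def case_prod_unfold)
  finally show ?thesis .
qed

text \<open>The quarter turn is a swap followed by a reflection of one coordinate, and the product measure is
  invariant under both.\<close>

lemma std_normal_pair_eq_rotated:
  "distr (std_normal_distribution \<Otimes>\<^sub>M std_normal_distribution)
     (std_normal_distribution \<Otimes>\<^sub>M std_normal_distribution) (\<lambda>(x, y). (- y, x)) =
   std_normal_distribution \<Otimes>\<^sub>M std_normal_distribution"
proof -
  let ?N = std_normal_distribution
  have "distr (?N \<Otimes>\<^sub>M ?N) (?N \<Otimes>\<^sub>M ?N) (\<lambda>(x, y). (- y, x)) =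
      distr (distr (?N \<Otimes>\<^sub>M ?N) (?N \<Otimes>\<^sub>M ?N) (\<lambda>(x, y). (y, x))) (?N \<Otimes>\<^sub>M ?N) (\<lambda>(x, y). (- x, y))"
    (is "_ = distr _ _ ?g")
    by (subst distr_distr) (simp_all add: comp_def case_prod_beta')
  also have "distr (?N \<Otimes>\<^sub>M ?N) (?N \<Otimes>\<^sub>M ?N) (\<lambda>(x, y). (y, x)) = ?N \<Otimes>\<^sub>M ?N"
    by (rule std_normal_pair.distr_pair_swap[symmetric])
  also have "distr \<dots> (?N \<Otimes>\<^sub>M ?N) ?g = distr (?N \<Otimes>\<^sub>M ?N) (borel \<Otimes>\<^sub>M borel) (\<lambda>(x, y). (- x, y))"
    by (rule distr_cong) (simp_all cong: sets_pair_measure_cong)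
  also have "\<dots> = distr ?N borel uminus \<Otimes>\<^sub>M distr ?N borel (\<lambda>x. x)"
    by (rule pair_measure_distr[symmetric])
       (simp_all add: distr_id2 std_normal.sigma_finite_measure_axioms)
  also have "\<dots> = ?N \<Otimes>\<^sub>M ?N"
    by (simp add: std_normal_eq_reflected distr_id2)
  finally show ?thesis .
qed

lemma complex_gaussian_eq_rotated: "distr complex_gaussian borel (\<lambda>z. \<i> * z) = complex_gaussian"
proof -
  let ?P = "std_normal_distribution \<Otimes>\<^sub>M std_normal_distribution"
  have "distr complex_gaussian borel (\<lambda>z. \<i> * z) = distr ?P borel (\<lambda>x. \<i> * complex_of_normals x)"
    unfolding complex_gaussian_eq by (subst distr_distr) (auto simp: comp_def)
  also have "(\<lambda>x. \<i> * complex_of_normals x) = complex_of_normals \<circ> (\<lambda>(x, y). (- y, x))"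
    by (auto simp: fun_eq_iff complex_of_normals_def complex_eq_iff)
  also have "distr ?P borel \<dots> = distr (distr ?P ?P (\<lambda>(x, y). (- y, x))) borel complex_of_normals"
    by (rule distr_distr[symmetric]) measurable
  finally show ?thesis
    by (simp only: std_normal_pair_eq_rotated complex_gaussian_eq)
qed

lemma integrable_complex_gaussian_iff:
  "f \<in> borel_measurable borel \<Longrightarrow> integrable complex_gaussian f \<longleftrightarrow>
    integrable (std_normal_distribution \<Otimes>\<^sub>M std_normal_distribution) (\<lambda>x. f (complex_of_normals x))"
  for f :: "complex \<Rightarrow> 'b::{banach, second_countable_topology}"
  unfolding complex_gaussian_eq by (rule integrable_distr_eq) measurable

lemma integral_complex_gaussian:
  "f \<in> borel_measurable borel \<Longrightarrow> integral\<^sup>L complex_gaussian f =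
    (\<integral>x. f (complex_of_normals x) \<partial>(std_normal_distribution \<Otimes>\<^sub>M std_normal_distribution))"
  for f :: "complex \<Rightarrow> 'b::{banach, second_countable_topology}"
  unfolding complex_gaussian_eq by (rule integral_distr) measurable

lemma integrable_norm_power_complex_gaussian: "integrable complex_gaussian (\<lambda>z. norm z ^ n)"
proof -
  let ?N = std_normal_distribution
  have "integrable ?N (\<lambda>x. \<bar>x\<bar> ^ k)" for k
    using integrable_std_normal_distribution_moment[of k, THEN integrable_abs] by (simp add: power_abs)
  then have "integrable (?N \<Otimes>\<^sub>M ?N) (\<lambda>x. \<Sum>k\<le>n. of_nat (n choose k) * (\<bar>fst x\<bar> ^ k * \<bar>snd x\<bar> ^ (n - k)))"
    using std_normal_pair.integrable_pair_mult[of "\<lambda>x. \<bar>x\<bar> ^ k" "\<lambda>x. \<bar>x\<bar> ^ (n - k)" for k]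
    by (intro Bochner_Integration.integrable_sum integrable_mult_right) simp
  then have "integrable (?N \<Otimes>\<^sub>M ?N) (\<lambda>x. norm (complex_of_normals x) ^ n)"
  proof (rule Bochner_Integration.integrable_bound)
    have "norm (complex_of_normals (x, y)) \<le> \<bar>x\<bar> + \<bar>y\<bar>" for x y
    proof -
      have "norm (complex_of_normals (x, y)) \<le> \<bar>sqrt (1/2) * x\<bar> + \<bar>sqrt (1/2) * y\<bar>"
        unfolding complex_of_normals_def using cmod_le[of "Complex (sqrt (1/2) * x) (sqrt (1/2) * y)"] by simp
      also have "\<dots> \<le> \<bar>x\<bar> + \<bar>y\<bar>"
        by (intro add_mono) (auto simp: abs_mult intro!: mult_left_le_one_le real_sqrt_le_1_iff[THEN iffD2])
      finally show ?thesis .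
    qed
    then have "norm (complex_of_normals (x, y)) ^ n \<le> (\<bar>x\<bar> + \<bar>y\<bar>) ^ n" for x y
      by (intro power_mono) auto
    then show "AE x in ?N \<Otimes>\<^sub>M ?N. norm (norm (complex_of_normals x) ^ n) \<le>
        norm (\<Sum>k\<le>n. of_nat (n choose k) * (\<bar>fst x\<bar> ^ k * \<bar>snd x\<bar> ^ (n - k)))"
      by (auto simp: binomial_ring mult.assoc sum_nonneg)
  qed measurable
  then show ?thesis
    by (subst integrable_complex_gaussian_iff) measurable
qed

lemma measurable_cnj_power [measurable]: "(\<lambda>z. z ^ p * cnj z ^ q) \<in> borel_measurable borel"
  using borel_measurable_cnj by measurable

lemma integrable_complex_gaussian_moment: "integrable complex_gaussian (\<lambda>z. z ^ p * cnj z ^ q)"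
proof (rule Bochner_Integration.integrable_bound[OF integrable_norm_power_complex_gaussian[of "p + q"]])
  show "(\<lambda>z. z ^ p * cnj z ^ q) \<in> borel_measurable complex_gaussian"
    using measurable_cnj_power measurable_cong_sets[OF sets_complex_gaussian refl] by blast
qed (auto simp: norm_mult norm_power power_add)

text \<open>If \<open>p \<noteq> q\<close>, rotating \<open>z\<close> by \<open>\<i>\<close> multiplies the moment by \<open>\<i>\<^sup>p (-\<i>)\<^sup>q\<close>. Since the law is
  invariant, the moment vanishes unless \<open>p\<close> and \<open>q\<close> agree modulo 4; the bound 2 on the exponents
  excludes coincidences between different ones. The diagonal moments are those of
  \<open>\<bar>z\<bar>\<^sup>2 = (x\<^sup>2 + y\<^sup>2) / 2\<close> with \<open>x\<close> and \<open>y\<close> standard normal.\<close>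

lemma complex_gaussian_moment:
  assumes "p \<le> 2" "q \<le> 2"
  shows "(\<integral>z. z ^ p * cnj z ^ q \<partial>complex_gaussian) = (if p = q then fact p else 0)"
proof (cases "p = q")
  case True
  let ?N = std_normal_distribution
  have int: "integrable (?N \<Otimes>\<^sub>M ?N) (\<lambda>x. fst x ^ j * snd x ^ k)"
    and mom: "(\<integral>x. fst x ^ j * snd x ^ k \<partial>(?N \<Otimes>\<^sub>M ?N)) = (\<integral>x. x ^ j \<partial>?N) * (\<integral>x. x ^ k \<partial>?N)" for j k
    by (rule std_normal_pair.integrable_pair_mult std_normal_pair.integral_pair_mult;
        rule integrable_std_normal_distribution_moment)+
  have one: "(\<integral>x. x ^ 0 \<partial>?N) = 1"
    using std_normal.prob_space by simp
  have sq: "(\<integral>x. x\<^sup>2 \<partial>?N) = 1" and qu: "(\<integral>x. x ^ 4 \<partial>?N) = 3"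
    using std_normal_distribution_even_moments(1)[of 1] std_normal_distribution_even_moments(1)[of 2]
    by (simp_all add: fact_numeral)
  consider "p = 0" | "p = 1" | "p = 2" using assms by linarith
  then have "(\<integral>z. norm z ^ (2 * p) \<partial>complex_gaussian) = fact p"
  proof cases
    case 1
    then show ?thesis using prob_space.prob_space[OF prob_space_complex_gaussian] by simp
  next
    case 2
    have "(\<integral>z. norm z ^ 2 \<partial>complex_gaussian) =
       (\<integral>x. (fst x ^ 2 * snd x ^ 0 + fst x ^ 0 * snd x ^ 2) / 2 \<partial>(?N \<Otimes>\<^sub>M ?N))"
    proof (subst integral_complex_gaussian)
      have "norm (complex_of_normals x) ^ 2 = (fst x ^ 2 * snd x ^ 0 + fst x ^ 0 * snd x ^ 2) / 2" for x
        by (simp add: complex_of_normals_def cmod_power2 power_mult_distrib power_divide)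
      then show "(\<integral>x. norm (complex_of_normals x) ^ 2 \<partial>(?N \<Otimes>\<^sub>M ?N)) =
          (\<integral>x. (fst x ^ 2 * snd x ^ 0 + fst x ^ 0 * snd x ^ 2) / 2 \<partial>(?N \<Otimes>\<^sub>M ?N))"
        by (simp only:)
    qed simp
    also have "\<dots> = 1"
      unfolding integral_divide_zero Bochner_Integration.integral_add[OF int int] mom sq one by simp
    finally show ?thesis using 2 by simp
  next
    case 3
    let ?f = "\<lambda>x :: real \<times> real. (fst x ^ 4 * snd x ^ 0 + 2 * (fst x ^ 2 * snd x ^ 2) + fst x ^ 0 * snd x ^ 4) / 4"
    have "(\<integral>z. norm z ^ 4 \<partial>complex_gaussian) = (\<integral>x. ?f x \<partial>(?N \<Otimes>\<^sub>M ?N))"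
    proof (subst integral_complex_gaussian)
      have "norm (complex_of_normals x) ^ 4 = ?f x" for x
      proof -
        have "norm (complex_of_normals x) ^ 4 = (norm (complex_of_normals x) ^ 2) ^ 2"
          by (simp only: power_mult[symmetric] mult_2_right numeral_plus_numeral add_num_simps)
        also have "norm (complex_of_normals x) ^ 2 = (fst x ^ 2 + snd x ^ 2) / 2"
          by (simp add: complex_of_normals_def cmod_power2 power_mult_distrib power_divide)
        also have "((fst x ^ 2 + snd x ^ 2) / 2) ^ 2 = ?f x"
          unfolding power_divide power2_sum power_mult[symmetric] by simp
        finally show ?thesis .
      qed
      then show "(\<integral>x. norm (complex_of_normals x) ^ 4 \<partial>(?N \<Otimes>\<^sub>M ?N)) = (\<integral>x. ?f x \<partial>(?N \<Otimes>\<^sub>M ?N))"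
        by (simp only:)
    qed simp
    also have "\<dots> = 2"
      unfolding integral_divide_zero
        Bochner_Integration.integral_add[OF Bochner_Integration.integrable_add[OF int integrable_mult_right[OF int]] int]
        Bochner_Integration.integral_add[OF int integrable_mult_right[OF int]]
        integral_mult_right_zero mom sq qu one by simp
    finally show ?thesis using 3 by simp
  qed
  moreover have "z ^ p * cnj z ^ q = complex_of_real (norm z ^ (2 * p))" for z
  proof -
    have "z ^ p * cnj z ^ q = (z * cnj z) ^ p"
      using True by (simp only: power_mult_distrib)
    then show ?thesis
      by (simp only: complex_norm_square[symmetric] of_real_power power_mult)
  qed
  ultimately have "(\<integral>z. z ^ p * cnj z ^ q \<partial>complex_gaussian) = complex_of_real (fact p)"
    by (simp only: integral_complex_of_real)
  then show ?thesis using True by simp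
next
  case False
  let ?I = "\<integral>z. z ^ p * cnj z ^ q \<partial>complex_gaussian"
  have "?I = (\<integral>z. z ^ p * cnj z ^ q \<partial>(distr complex_gaussian borel (\<lambda>z. \<i> * z)))"
    by (simp only: complex_gaussian_eq_rotated)
  also have "\<dots> = (\<integral>z. (\<i> * z) ^ p * cnj (\<i> * z) ^ q \<partial>complex_gaussian)"
  proof (rule integral_distr[OF _ measurable_cnj_power])
    have "(\<lambda>z::complex. \<i> * z) \<in> borel_measurable borel" by simp
    then show "(\<lambda>z. \<i> * z) \<in> borel_measurable complex_gaussian"
      using measurable_cong_sets[OF sets_complex_gaussian refl] by blast
  qed
  also have "\<dots> = \<i> ^ p * (- \<i>) ^ q * ?I"
  proof -
    have "(\<i> * z) ^ p * cnj (\<i> * z) ^ q = \<i> ^ p * (- \<i>) ^ q * (z ^ p * cnj z ^ q)" for z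
      by (simp only: complex_cnj_mult complex_cnj_i power_mult_distrib mult_ac)
    then show ?thesis
      by (simp only: integral_mult_right_zero)
  qed
  finally have "?I - \<i> ^ p * (- \<i>) ^ q * ?I = 0"
    by (simp only: right_minus_eq)
  then have "(1 - \<i> ^ p * (- \<i>) ^ q) * ?I = 0"
    by (simp only: left_diff_distrib mult_1_left)
  moreover have "\<i> ^ p * (- \<i>) ^ q \<noteq> 1"
  proof -
    have "p \<in> {0, 1, 2}" "q \<in> {0, 1, 2}" using assms by auto
    then show ?thesis using False by (auto simp: complex_eq_iff)
  qed
  ultimately show ?thesis using False by simp
qed

lemma
  fixes p q :: "'n::finite \<Rightarrow> nat"
  assumes "\<And>m. p m \<le> 2" "\<And>m. q m \<le> 2"
  shows integrable_gaussian_monomial: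
      "integrable (\<Pi>\<^sub>M m\<in>UNIV. complex_gaussian) (\<lambda>a. \<Prod>m\<in>UNIV. a m ^ p m * cnj (a m) ^ q m)"
    and integral_gaussian_monomial:
      "(\<integral>a. (\<Prod>m\<in>UNIV. a m ^ p m * cnj (a m) ^ q m) \<partial>(\<Pi>\<^sub>M m\<in>UNIV. complex_gaussian)) =
        (\<Prod>m\<in>UNIV. if p m = q m then fact (p m) else 0)"
proof -
  interpret product_prob_space "\<lambda>_ :: 'n. complex_gaussian"
    by (rule product_prob_spaceI) (rule prob_space_complex_gaussian)
  show "integrable (\<Pi>\<^sub>M m\<in>UNIV. complex_gaussian) (\<lambda>a. \<Prod>m\<in>UNIV. a m ^ p m * cnj (a m) ^ q m)"
    by (rule product_integrable_prod[OF finite integrable_complex_gaussian_moment])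
  show "(\<integral>a. (\<Prod>m\<in>UNIV. a m ^ p m * cnj (a m) ^ q m) \<partial>(\<Pi>\<^sub>M m\<in>UNIV. complex_gaussian)) =
      (\<Prod>m\<in>UNIV. if p m = q m then fact (p m) else 0)"
    unfolding product_integral_prod[OF finite integrable_complex_gaussian_moment]
    by (simp only: complex_gaussian_moment assms)
qed

text \<open>Writes a single coordinate as a monomial in all coordinates, so that products of entries become
  instances of \<open>integral_gaussian_monomial\<close>.\<close>

lemma prod_power_of_bool: "(\<Prod>m\<in>UNIV. f m ^ of_bool (m = i)) = f i"
  for f :: "'n::finite \<Rightarrow> 'a::comm_semiring_1"
proof -
  have "(\<Prod>m\<in>UNIV. f m ^ of_bool (m = i)) = (\<Prod>m\<in>UNIV. if m = i then f m else 1)"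
    by (intro prod.cong) auto
  then show ?thesis by simp
qed

lemma
  fixes i j :: "'n::finite"
  shows integrable_entry: "integrable (\<Pi>\<^sub>M i\<in>UNIV. complex_gaussian) (\<lambda>a. a i * cnj (a j))"
    and integral_entry: "(\<integral>a. a i * cnj (a j) \<partial>(\<Pi>\<^sub>M i\<in>UNIV. complex_gaussian)) = of_bool (i = j)"
proof -
  define p q :: "'n \<Rightarrow> nat" where "p m = of_bool (m = i)" and "q m = of_bool (m = j)" for m
  have pq: "p m \<le> 2" "q m \<le> 2" for m
    by (auto simp: p_def q_def)
  have eq: "a i * cnj (a j) = (\<Prod>m\<in>UNIV. a m ^ p m * cnj (a m) ^ q m)" for a
    unfolding p_def q_def prod.distrib prod_power_of_bool ..
  show "integrable (\<Pi>\<^sub>M i\<in>UNIV. complex_gaussian) (\<lambda>a. a i * cnj (a j))"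
    unfolding eq by (rule integrable_gaussian_monomial[OF pq])
  have "(\<Prod>m\<in>UNIV. if p m = q m then fact (p m) else 0) = (of_bool (i = j) :: complex)"
  proof (cases "i = j")
    case True
    then show ?thesis by (auto simp: p_def q_def intro!: prod.neutral)
  next
    case False
    then have "p i \<noteq> q i" by (simp add: p_def q_def)
    then have "(\<Prod>m\<in>UNIV. if p m = q m then fact (p m) else 0) = (0 :: complex)"
      by (intro prod_zero) auto
    then show ?thesis using False by simp
  qed
  then show "(\<integral>a. a i * cnj (a j) \<partial>(\<Pi>\<^sub>M i\<in>UNIV. complex_gaussian)) = of_bool (i = j)"
    unfolding eq integral_gaussian_monomial[OF pq] .
qed

text \<open>The expectation is nonzero only if each index occurs equally often with and without conjugation,
  that is, if \<open>{i, k}\<close> and \<open>{j, l}\<close> agree as multisets. Then it is 1, except that it is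
  \<open>E \<bar>z\<bar>\<^sup>4 = 2\<close> when all four indices coincide, where both pairings contribute.\<close>

lemma wick_complex_gaussian:
  fixes i j k l :: "'n::finite"
  shows "(\<integral>a. a i * cnj (a j) * (a k * cnj (a l)) \<partial>(\<Pi>\<^sub>M i\<in>UNIV. complex_gaussian)) =
    of_bool (i = j \<and> k = l) + of_bool (i = l \<and> j = k)" (is "integral\<^sup>L ?P _ = _")
    and integrable_wick: "integrable (\<Pi>\<^sub>M i\<in>UNIV. complex_gaussian) (\<lambda>a. a i * cnj (a j) * (a k * cnj (a l)))"
proof -
  define p q :: "'n \<Rightarrow> nat" where "p m = of_bool (m = i) + of_bool (m = k)"
    and "q m = of_bool (m = j) + of_bool (m = l)" for m
  have pq_le: "p m \<le> 2" "q m \<le> 2" for m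
    by (auto simp: p_def q_def)
  have eq: "a i * cnj (a j) * (a k * cnj (a l)) = (\<Prod>m\<in>UNIV. a m ^ p m * cnj (a m) ^ q m)" for a
    unfolding p_def q_def power_add prod.distrib prod_power_of_bool by (simp only: mult_ac)
  show "integrable ?P (\<lambda>a. a i * cnj (a j) * (a k * cnj (a l)))"
    unfolding eq by (rule integrable_gaussian_monomial[OF pq_le])
  have "integral\<^sup>L ?P (\<lambda>a. a i * cnj (a j) * (a k * cnj (a l))) =
      (\<Prod>m\<in>UNIV. if p m = q m then fact (p m) else 0)"
    unfolding eq by (rule integral_gaussian_monomial[OF pq_le])
  also have "\<dots> = of_bool (i = j \<and> k = l) + of_bool (i = l \<and> j = k)"
  proof (cases "p = q")
    case True
    then have "of_bool (m = i) + of_bool (m = k) = (of_bool (m = j) + of_bool (m = l) :: nat)" for m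
      by (simp add: p_def q_def fun_eq_iff)
    note pq = this
    have "(i = j \<and> k = l) \<or> (i = l \<and> k = j)"
    proof (cases "i = j")
      case True
      then show ?thesis using pq[of k] by (simp add: of_bool_def split: if_splits)
    next
      case False
      then have "i = l" using pq[of i] by (simp add: of_bool_def split: if_splits)
      then show ?thesis using pq[of k] by (simp add: of_bool_def split: if_splits)
    qed
    moreover have "(\<Prod>m\<in>UNIV. fact (p m)) = (if i = k then 2 else 1 :: complex)"
    proof -
      have "(\<Prod>m\<in>UNIV. fact (p m)) = (\<Prod>m\<in>UNIV. if m = i \<and> i = k then 2 else 1 :: complex)"
        by (intro prod.cong) (auto simp: p_def fact_numeral)
      then show ?thesis by (cases "i = k") simp_all
    qed
    ultimately show ?thesis
      using True by (auto simp: doubleton_eq_iff)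
  next
    case False
    have no_pairing: "\<not> (i = j \<and> k = l)" "\<not> (i = l \<and> j = k)"
      using False by (auto simp: p_def q_def fun_eq_iff)
    obtain m where "p m \<noteq> q m"
      using False by blast
    then have "(\<Prod>m\<in>UNIV. if p m = q m then fact (p m) else 0) = (0 :: complex)"
      by (intro prod_zero) auto
    moreover have "of_bool (i = j \<and> k = l) = (0 :: complex)" "of_bool (i = l \<and> j = k) = (0 :: complex)"
      by (rule of_bool_eq_0_iff[THEN iffD2], fact no_pairing)+
    ultimately show ?thesis by (simp only: add_0_left)
  qed
  finally show "integral\<^sup>L ?P (\<lambda>a. a i * cnj (a j) * (a k * cnj (a l))) =
    of_bool (i = j \<and> k = l) + of_bool (i = l \<and> j = k)" .
qed

section \<open>The characteristic function of the GUE\<close>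

text \<open>The orthogonal projection onto the Hermitian matrices, for the real inner product of the
  Euclidean space of all complex matrices.\<close>

definition hermitian_part :: "complex ^ 'n ^ 'n \<Rightarrow> complex ^ 'n ^ 'n" where
  "hermitian_part A = (\<chi> i j. (A $ i $ j + cnj (A $ j $ i)) / 2)"

lemma hermitian_part_component: "hermitian_part A $ i $ j = (A $ i $ j + cnj (A $ j $ i)) / 2"
  by (simp add: hermitian_part_def)

lemma norm_matrix_squared: "(norm A)\<^sup>2 = (\<Sum>i\<in>UNIV. \<Sum>j\<in>UNIV. (norm (A $ i $ j))\<^sup>2)"
  for A :: "'a::real_inner ^ 'n ^ 'm"
  by (simp add: power2_norm_eq_inner inner_vec_def)

lemma inner_matrix: "A \<bullet> B = (\<Sum>i\<in>UNIV. \<Sum>j\<in>UNIV. A $ i $ j \<bullet> B $ i $ j)"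
  for A :: "'a::real_inner ^ 'n ^ 'm"
  by (simp add: inner_vec_def)

text \<open>The independent entries of the GUE are those on and above the diagonal, so double sums are
  rearranged accordingly.\<close>

lemma sum_diagonal_upper_lower:
  fixes F :: "'n::{finite, linorder} \<Rightarrow> 'n \<Rightarrow> 'b::comm_monoid_add"
  shows "(\<Sum>i\<in>UNIV. \<Sum>j\<in>UNIV. F i j) =
    (\<Sum>i\<in>UNIV. F i i) + (\<Sum>(i, j)\<in>{(i, j). i < j}. F i j + F j i)"
proof -
  let ?U = "{(i :: 'n, j). i < j}" and ?L = "{(i :: 'n, j). j < i}" and ?D = "(\<lambda>i :: 'n. (i, i)) ` UNIV"
  have "(\<Sum>i\<in>UNIV. \<Sum>j\<in>UNIV. F i j) = (\<Sum>(i, j)\<in>UNIV. F i j)"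
    by (simp add: sum.cartesian_product)
  also have "UNIV = ?D \<union> (?U \<union> ?L)"
    by auto
  also have "(\<Sum>(i, j)\<in>?D \<union> (?U \<union> ?L). F i j) =
      (\<Sum>(i, j)\<in>?D. F i j) + ((\<Sum>(i, j)\<in>?U. F i j) + (\<Sum>(i, j)\<in>?L. F i j))"
    by (subst sum.union_disjoint; (subst sum.union_disjoint)?) auto
  also have "(\<Sum>(i, j)\<in>?D. F i j) = (\<Sum>i\<in>UNIV. F i i)"
    by (subst sum.reindex) (auto simp: inj_on_def)
  also have "(\<Sum>(i, j)\<in>?L. F i j) = (\<Sum>(i, j)\<in>?U. F j i)"
    by (rule sum.reindex_bij_witness[of _ prod.swap prod.swap]) auto
  also have "(\<Sum>(i, j)\<in>?U. F i j) + (\<Sum>(i, j)\<in>?U. F j i) = (\<Sum>(i, j)\<in>?U. F i j + F j i)"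
    by (simp add: sum.distrib case_prod_beta)
  finally show ?thesis .
qed

lemma char_real_gaussian: "(\<integral>x. iexp (t * x) \<partial>real_gaussian) = exp (- (t\<^sup>2 / 2))"
proof -
  have "char real_gaussian t = exp (- (t\<^sup>2) / 2)"
    by (simp add: real_gaussian_def char_std_normal_distribution)
  then show ?thesis
    by (simp add: char_def)
qed

lemma char_complex_gaussian: "(\<integral>z. iexp (w \<bullet> z) \<partial>complex_gaussian) = exp (- ((norm w)\<^sup>2 / 4))"
proof -
  let ?N = std_normal_distribution and ?s = "sqrt (1/2) :: real"
  have int: "integrable ?N (\<lambda>x. iexp (a * x))" for a :: real
    by (rule std_normal.integrable_const_bound[of _ 1]) auto
  have char: "(\<integral>x. iexp (a * x) \<partial>?N) = exp (- (a\<^sup>2 / 2))" for a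
    using char_real_gaussian by (simp add: real_gaussian_def)
  have "(\<integral>z. iexp (w \<bullet> z) \<partial>complex_gaussian) =
      (\<integral>x. iexp (w \<bullet> complex_of_normals x) \<partial>(?N \<Otimes>\<^sub>M ?N))"
    by (rule integral_complex_gaussian) simp
  also have "\<dots> = (\<integral>x. iexp (Re w * ?s * fst x) * iexp (Im w * ?s * snd x) \<partial>(?N \<Otimes>\<^sub>M ?N))"
    by (simp add: complex_of_normals_def inner_complex_def algebra_simps exp_add[symmetric])
  also have "\<dots> = exp (- ((Re w * ?s)\<^sup>2 / 2)) * exp (- ((Im w * ?s)\<^sup>2 / 2))"
    using std_normal_pair.integral_pair_mult[OF int int, of "Re w * ?s" "Im w * ?s"]
    unfolding char of_real_mult[symmetric] by simp
  also have "\<dots> = exp (- ((norm w)\<^sup>2 / 4))"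
    by (simp add: cmod_power2 power_mult_distrib power_divide exp_add[symmetric] add_divide_distrib)
  finally show ?thesis .
qed

text \<open>The entries at \<open>(i, j)\<close> and \<open>(j, i)\<close> are conjugate, and their joint contribution pairs \<open>z\<^sub>i\<^sub>j\<close> with
  twice the entry of the Hermitian part of \<open>t\<close>. This exhibits \<open>\<langle>t, X\<rangle>\<close> as a sum of independent
  Gaussians.\<close>

lemma inner_GUE_matrix:
  fixes t :: "complex ^ ('n :: {finite, linorder}) ^ ('n :: {finite, linorder})"
  shows "t \<bullet> GUE_matrix x = (\<Sum>i\<in>UNIV. Re (t $ i $ i) * fst x i) +
    (\<Sum>ij\<in>{(i, j). i < j}. (2 * hermitian_part t $ fst ij $ snd ij) \<bullet> snd x ij)"
proof -
  let ?F = "\<lambda>i j. t $ i $ j \<bullet> GUE_matrix x $ i $ j"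
  have "t \<bullet> GUE_matrix x = (\<Sum>i\<in>UNIV. ?F i i) + (\<Sum>(i, j)\<in>{(i, j). i < j}. ?F i j + ?F j i)"
    unfolding inner_matrix by (rule sum_diagonal_upper_lower)
  also have "(\<Sum>i\<in>UNIV. ?F i i) = (\<Sum>i\<in>UNIV. Re (t $ i $ i) * fst x i)"
    by (simp add: GUE_matrix_def case_prod_beta inner_complex_def)
  also have "(\<Sum>(i, j)\<in>{(i, j). i < j}. ?F i j + ?F j i) =
      (\<Sum>ij\<in>{(i, j). i < j}. (2 * hermitian_part t $ fst ij $ snd ij) \<bullet> snd x ij)"
  proof (intro sum.cong refl)
    fix ij :: "'n \<times> 'n" assume "ij \<in> {(i, j). i < j}"
    then obtain i j where ij: "ij = (i, j)" "i < j" by auto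
    then have "i \<noteq> j" "j \<noteq> i" "\<not> j < i" by auto
    with ij show "(case ij of (i, j) \<Rightarrow> ?F i j + ?F j i) =
        (2 * hermitian_part t $ fst ij $ snd ij) \<bullet> snd x ij"
      by (simp add: GUE_matrix_def case_prod_beta hermitian_part_component inner_complex_def field_simps)
  qed
  finally show ?thesis .
qed

lemma integral_GUE:
  fixes f :: "complex ^ ('n :: {finite, linorder}) ^ ('n :: {finite, linorder}) \<Rightarrow> 'b::{banach, second_countable_topology}"
  assumes "f \<in> borel_measurable borel"
  shows "integral\<^sup>L GUE f = (\<integral>x. f (GUE_matrix x)
    \<partial>((\<Pi>\<^sub>M i\<in>UNIV. real_gaussian) \<Otimes>\<^sub>M (\<Pi>\<^sub>M ij\<in>{(i, j). i < j}. complex_gaussian)))"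
  unfolding GUE_def by (intro integral_distr measurable_GUE_matrix measurable_restrict_space1 assms)

text \<open>By independence the characteristic function is a product over the entries. In the exponent a
  diagonal entry contributes \<open>T\<^sub>i\<^sub>i\<^sup>2 / 2\<close> and an entry above the diagonal \<open>\<bar>2 T\<^sub>i\<^sub>j\<bar>\<^sup>2 / 4\<close>, which is the
  half of \<open>\<bar>T\<^sub>i\<^sub>j\<bar>\<^sup>2 + \<bar>T\<^sub>j\<^sub>i\<bar>\<^sup>2\<close>; together they give \<open>\<parallel>T\<parallel>\<^sup>2 / 2\<close>.\<close>

theorem char_GUE:
  fixes t :: "complex ^ ('n :: {finite, linorder}) ^ ('n :: {finite, linorder})"
  shows "(\<integral>H. iexp (t \<bullet> H) \<partial>GUE) = exp (- ((norm (hermitian_part t))\<^sup>2 / 2))"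
proof -
  let ?U = "{(i :: 'n, j). i < j}"
  let ?R = "\<Pi>\<^sub>M i\<in>(UNIV :: 'n set). real_gaussian" and ?C = "\<Pi>\<^sub>M ij\<in>?U. complex_gaussian"
  interpret R: product_prob_space "\<lambda>_ :: 'n. real_gaussian" UNIV
    by (rule product_prob_spaceI) (rule prob_space_real_gaussian)
  interpret C: product_prob_space "\<lambda>_ :: 'n \<times> 'n. complex_gaussian" ?U
    by (rule product_prob_spaceI) (rule prob_space_complex_gaussian)
  interpret RC: pair_prob_space ?R ?C ..
  define w where "w ij = 2 * hermitian_part t $ fst ij $ snd ij" for ij :: "'n \<times> 'n"
  define f where "f d = (\<Prod>i\<in>UNIV. iexp (Re (t $ i $ i) * d i))" for d :: "'n \<Rightarrow> real"
  define g where "g z = (\<Prod>ij\<in>?U. iexp (w ij \<bullet> z ij))" for z :: "'n \<times> 'n \<Rightarrow> complex"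
  have int_real: "integrable real_gaussian (\<lambda>x. iexp (a * x))" for a
    by (rule finite_measure.integrable_const_bound[of _ _ 1])
       (auto simp: prob_space.finite_measure[OF prob_space_real_gaussian])
  have int_complex: "integrable complex_gaussian (\<lambda>z. iexp (a \<bullet> z))" for a
    by (rule finite_measure.integrable_const_bound[of _ _ 1])
       (auto simp: prob_space.finite_measure[OF prob_space_complex_gaussian])
  have "(\<integral>H. iexp (t \<bullet> H) \<partial>GUE) = (\<integral>x. iexp (t \<bullet> GUE_matrix x) \<partial>(?R \<Otimes>\<^sub>M ?C))"
    by (rule integral_GUE) (intro borel_measurable_continuous_onI continuous_intros)
  also have "\<dots> = (\<integral>x. f (fst x) * g (snd x) \<partial>(?R \<Otimes>\<^sub>M ?C))"
    by (simp add: inner_GUE_matrix f_def g_def w_def exp_add exp_sum sum_distrib_left distrib_left)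
  also have "\<dots> = integral\<^sup>L ?R f * integral\<^sup>L ?C g"
  proof (rule RC.integral_pair_mult)
    show "integrable ?R f"
      unfolding f_def by (rule R.product_integrable_prod[OF finite int_real])
    show "integrable ?C g"
      unfolding g_def by (rule C.product_integrable_prod[OF finite int_complex])
  qed
  also have "integral\<^sup>L ?R f = (\<Prod>i\<in>UNIV. exp (- ((Re (t $ i $ i))\<^sup>2 / 2)))"
    unfolding f_def R.product_integral_prod[OF finite int_real] char_real_gaussian by (simp only: of_real_prod)
  also have "integral\<^sup>L ?C g = (\<Prod>ij\<in>?U. exp (- ((norm (w ij))\<^sup>2 / 4)))"
    unfolding g_def C.product_integral_prod[OF finite int_complex] char_complex_gaussian by (simp only: of_real_prod)
  also have "complex_of_real (\<Prod>i\<in>UNIV. exp (- ((Re (t $ i $ i))\<^sup>2 / 2))) *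
      complex_of_real (\<Prod>ij\<in>?U. exp (- ((norm (w ij))\<^sup>2 / 4))) =
      exp (- ((\<Sum>i\<in>UNIV. (Re (t $ i $ i))\<^sup>2) + (\<Sum>ij\<in>?U. (norm (w ij))\<^sup>2 / 2)) / 2)"
    by (simp add: exp_sum[symmetric] exp_add[symmetric] sum_negf sum_divide_distrib[symmetric]
        add_divide_distrib flip: of_real_mult)
  also have "(\<Sum>i\<in>UNIV. (Re (t $ i $ i))\<^sup>2) + (\<Sum>ij\<in>?U. (norm (w ij))\<^sup>2 / 2) = (norm (hermitian_part t))\<^sup>2"
  proof -
    have "cnj (hermitian_part t $ j $ i) = hermitian_part t $ i $ j" for i j
      by (simp add: hermitian_part_component add.commute)
    then have sym: "norm (hermitian_part t $ j $ i) = norm (hermitian_part t $ i $ j)" for i j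
      by (metis complex_mod_cnj)
    have "hermitian_part t $ i $ i = of_real (Re (t $ i $ i))" for i
      by (simp add: hermitian_part_component complex_eq_iff)
    then have diag: "(norm (hermitian_part t $ i $ i))\<^sup>2 = (Re (t $ i $ i))\<^sup>2" for i
      by simp
    have off: "(norm (w (i, j)))\<^sup>2 / 2 = (norm (hermitian_part t $ i $ j))\<^sup>2 + (norm (hermitian_part t $ j $ i))\<^sup>2" for i j
      unfolding sym[of j i] by (simp add: w_def norm_mult power_mult_distrib)
    have "(\<Sum>ij\<in>?U. (norm (w ij))\<^sup>2 / 2) =
        (\<Sum>(i, j)\<in>?U. (norm (hermitian_part t $ i $ j))\<^sup>2 + (norm (hermitian_part t $ j $ i))\<^sup>2)"
      by (intro sum.cong refl) (auto simp only: off split: prod.splits)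
    then show ?thesis
      unfolding norm_matrix_squared sum_diagonal_upper_lower[of "\<lambda>i j. (norm (hermitian_part t $ i $ j))\<^sup>2"] diag
      by simp
  qed
  finally show ?thesis
    by simp
qed

section \<open>The central limit theorem for linear forms of the LUE\<close>

text \<open>On Hermitian matrices the real inner product is a complex linear combination of the entries, so
  that second moments of linear forms can be computed from those of the entries.\<close>

lemma inner_hermitian_matrix:
  fixes t Z :: "complex ^ 'n ^ 'n"
  assumes "ctranspose Z = Z"
  shows "complex_of_real (t \<bullet> Z) = (\<Sum>i\<in>UNIV. \<Sum>j\<in>UNIV. cnj (hermitian_part t $ i $ j) * Z $ i $ j)"
proof -
  have Z: "cnj (Z $ i $ j) = Z $ j $ i" for i j
    using arg_cong[OF assms, of "\<lambda>M. M $ j $ i"] by (simp add: ctranspose_def)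
  have "complex_of_real (a \<bullet> b) = cnj a * b / 2 + a * cnj b / 2" for a b
    by (simp add: complex_eq_iff inner_complex_def field_simps)
  then have "complex_of_real (t \<bullet> Z) =
      (\<Sum>i\<in>UNIV. \<Sum>j\<in>UNIV. cnj (t $ i $ j) * Z $ i $ j / 2) + (\<Sum>i\<in>UNIV. \<Sum>j\<in>UNIV. t $ i $ j * Z $ j $ i / 2)"
    by (simp only: inner_matrix of_real_sum Z sum.distrib)
  also have "(\<Sum>i\<in>UNIV. \<Sum>j\<in>UNIV. t $ i $ j * Z $ j $ i / 2) = (\<Sum>i\<in>UNIV. \<Sum>j\<in>UNIV. t $ j $ i * Z $ i $ j / 2)"
    by (rule sum.swap)
  finally have "complex_of_real (t \<bullet> Z) =
      (\<Sum>i\<in>UNIV. \<Sum>j\<in>UNIV. cnj (t $ i $ j) * Z $ i $ j / 2 + t $ j $ i * Z $ i $ j / 2)"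
    by (simp only: sum.distrib)
  also have "\<dots> = (\<Sum>i\<in>UNIV. \<Sum>j\<in>UNIV. cnj (hermitian_part t $ i $ j) * Z $ i $ j)"
    by (intro sum.cong refl) (simp add: hermitian_part_component field_simps)
  finally show ?thesis .
qed

definition outer_product :: "('n \<Rightarrow> complex) \<Rightarrow> complex ^ 'n ^ 'n" where
  "outer_product a = (\<chi> i j. a i * cnj (a j))"

definition centred_entry :: "'n \<Rightarrow> 'n \<Rightarrow> ('n \<Rightarrow> complex) \<Rightarrow> complex" where
  "centred_entry i j a = a i * cnj (a j) - of_bool (i = j)"

lemma
  fixes i j k l :: "'n::finite"
  shows mean_centred_entry:
      "has_bochner_integral (\<Pi>\<^sub>M i\<in>UNIV. complex_gaussian) (centred_entry i j) 0"
    and covariance_centred_entry: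
      "has_bochner_integral (\<Pi>\<^sub>M i\<in>UNIV. complex_gaussian)
         (\<lambda>a. centred_entry i j a * centred_entry k l a) (of_bool (i = l \<and> j = k))"
proof -
  let ?P = "\<Pi>\<^sub>M i\<in>(UNIV :: 'n set). complex_gaussian"
  interpret prob_space ?P
    by (intro prob_space_PiM prob_space_complex_gaussian)
  have eq: "centred_entry i j a * centred_entry k l a =
      (a i * cnj (a j) * (a k * cnj (a l)) - of_bool (k = l) * (a i * cnj (a j)))
      - (of_bool (i = j) * (a k * cnj (a l)) - of_bool (i = j) * of_bool (k = l))" for a
    by (simp add: centred_entry_def algebra_simps)
  have entry: "has_bochner_integral ?P (\<lambda>a. a m * cnj (a n)) (of_bool (m = n))" for m n
    by (simp only: has_bochner_integral_iff integrable_entry integral_entry simp_thms)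
  have wick: "has_bochner_integral ?P (\<lambda>a. a i * cnj (a j) * (a k * cnj (a l)))
      (of_bool (i = j \<and> k = l) + of_bool (i = l \<and> j = k))"
    by (simp only: has_bochner_integral_iff integrable_wick wick_complex_gaussian simp_thms)
  have const: "has_bochner_integral ?P (\<lambda>a. c) c" for c :: complex
    by (simp add: has_bochner_integral_iff prob_space)
  have "has_bochner_integral ?P (\<lambda>a. a i * cnj (a j) - of_bool (i = j)) (of_bool (i = j) - of_bool (i = j))"
    by (intro has_bochner_integral_diff entry const)
  then show "has_bochner_integral ?P (centred_entry i j) 0"
    by (simp only: centred_entry_def[abs_def] diff_self)
  have "has_bochner_integral ?P (\<lambda>a. centred_entry i j a * centred_entry k l a)
     ((of_bool (i = j \<and> k = l) + of_bool (i = l \<and> j = k) - of_bool (k = l) * of_bool (i = j))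
      - (of_bool (i = j) * of_bool (k = l) - of_bool (i = j) * of_bool (k = l)))"
    unfolding eq by (intro has_bochner_integral_diff has_bochner_integral_mult_right entry wick const)
  also have "(of_bool (i = j \<and> k = l) + of_bool (i = l \<and> j = k) - of_bool (k = l) * of_bool (i = j))
      - (of_bool (i = j) * of_bool (k = l) - of_bool (i = j) * of_bool (k = l)) =
      (of_bool (i = l \<and> j = k) :: complex)"
    by (simp only: of_bool_conj diff_self diff_zero add_diff_cancel_left' mult.commute)
  finally show "has_bochner_integral ?P (\<lambda>a. centred_entry i j a * centred_entry k l a)
      (of_bool (i = l \<and> j = k))" .
qed

text \<open>The linear form \<open>t\<close>, evaluated at the contribution \<open>a a\<^sup>* - Id\<close> of one column \<open>a\<close>.\<close>

definition centred_form :: "complex ^ 'n ^ 'n \<Rightarrow> ('n \<Rightarrow> complex) \<Rightarrow> real" where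
  "centred_form t a = t \<bullet> (outer_product a - mat 1)"

lemma centred_form_eq:
  "complex_of_real (centred_form t a) =
    (\<Sum>ij\<in>UNIV. cnj (hermitian_part t $ fst ij $ snd ij) * centred_entry (fst ij) (snd ij) a)"
proof -
  have "ctranspose (outer_product a - mat 1) = outer_product a - mat 1"
    by (simp add: ctranspose_def outer_product_def mat_def vec_eq_iff mult.commute)
  from inner_hermitian_matrix[OF this, of t] show ?thesis
    unfolding centred_form_def
    by (simp add: sum.cartesian_product case_prod_beta outer_product_def mat_def centred_entry_def of_bool_def)
qed

lemma measurable_centred_form [measurable]:
  fixes t :: "complex ^ 'n ^ 'n"
  shows "centred_form t \<in> borel_measurable (\<Pi>\<^sub>M i\<in>UNIV. complex_gaussian)"
proof -
  let ?P = "\<Pi>\<^sub>M i\<in>(UNIV :: 'n set). complex_gaussian"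
  have "(\<lambda>a. complex_of_real (centred_form t a)) \<in> borel_measurable ?P"
    unfolding centred_form_eq
    by (intro borel_measurable_sum borel_measurable_times borel_measurable_const
        borel_measurable_has_bochner_integral[OF mean_centred_entry])
  from measurable_compose[OF this borel_measurable_Re] show ?thesis by simp
qed

text \<open>With \<open>T\<close> the Hermitian part of \<open>t\<close>, the variance is the sum of \<open>cnj T\<^sub>i\<^sub>j cnj T\<^sub>k\<^sub>l \<delta>\<^sub>i\<^sub>l \<delta>\<^sub>j\<^sub>k\<close>, where
  only \<open>(k, l) = (j, i)\<close> survives and \<open>cnj T\<^sub>j\<^sub>i = T\<^sub>i\<^sub>j\<close>. It agrees with the variance of the
  corresponding linear form of the GUE.\<close>

lemma
  fixes t :: "complex ^ 'n ^ 'n"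
  shows integral_centred_form: "(\<integral>a. centred_form t a \<partial>(\<Pi>\<^sub>M i\<in>UNIV. complex_gaussian)) = 0"
    and integrable_centred_form_squared:
      "integrable (\<Pi>\<^sub>M i\<in>UNIV. complex_gaussian) (\<lambda>a. (centred_form t a)\<^sup>2)"
    and integral_centred_form_squared:
      "(\<integral>a. (centred_form t a)\<^sup>2 \<partial>(\<Pi>\<^sub>M i\<in>UNIV. complex_gaussian)) = (norm (hermitian_part t))\<^sup>2"
proof -
  let ?P = "\<Pi>\<^sub>M i\<in>(UNIV :: 'n set). complex_gaussian"
  interpret prob_space ?P
    by (intro prob_space_PiM prob_space_complex_gaussian)
  define T where "T ij = hermitian_part t $ fst ij $ snd ij" for ij
  have form: "complex_of_real (centred_form t a) = (\<Sum>ij\<in>UNIV. cnj (T ij) * centred_entry (fst ij) (snd ij) a)" for a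
    unfolding centred_form_eq T_def ..
  have "has_bochner_integral ?P (\<lambda>a. complex_of_real (centred_form t a)) (\<Sum>ij\<in>(UNIV :: ('n \<times> 'n) set). cnj (T ij) * 0)"
    unfolding form by (intro has_bochner_integral_sum has_bochner_integral_mult_right mean_centred_entry)
  then have "has_bochner_integral ?P (\<lambda>a. centred_form t a) 0"
    by (drule_tac has_bochner_integral_Re)
       (simp only: Re_complex_of_real mult_zero_right sum.neutral_const complex.sel zero_complex.sel)
  then show "(\<integral>a. centred_form t a \<partial>?P) = 0"
    by (rule has_bochner_integral_integral_eq)
  have square: "complex_of_real ((centred_form t a)\<^sup>2) = (\<Sum>ij\<in>UNIV. \<Sum>kl\<in>UNIV. (cnj (T ij) * cnj (T kl)) *
      (centred_entry (fst ij) (snd ij) a * centred_entry (fst kl) (snd kl) a))" for a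
    unfolding power2_eq_square of_real_mult form sum_product by (simp only: mult_ac)
  have "has_bochner_integral ?P (\<lambda>a. complex_of_real ((centred_form t a)\<^sup>2))
      (\<Sum>ij\<in>UNIV. \<Sum>kl\<in>UNIV. (cnj (T ij) * cnj (T kl)) * of_bool (fst ij = snd kl \<and> snd ij = fst kl))"
    unfolding square
    by (intro has_bochner_integral_sum has_bochner_integral_mult_right covariance_centred_entry)
  also have "(\<Sum>ij\<in>UNIV. \<Sum>kl\<in>UNIV. (cnj (T ij) * cnj (T kl)) * of_bool (fst ij = snd kl \<and> snd ij = fst kl)) =
      (\<Sum>ij\<in>UNIV. \<Sum>kl\<in>UNIV. if kl = prod.swap ij then cnj (T ij) * cnj (T kl) else 0)"
  proof (intro sum.cong refl)
    fix ij kl :: "'n \<times> 'n"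
    have "fst ij = snd kl \<and> snd ij = fst kl \<longleftrightarrow> kl = prod.swap ij"
      by (cases ij, cases kl) auto
    then show "(cnj (T ij) * cnj (T kl)) * of_bool (fst ij = snd kl \<and> snd ij = fst kl) =
        (if kl = prod.swap ij then cnj (T ij) * cnj (T kl) else 0)"
      by (simp only: of_bool_def if_distrib[of "\<lambda>x. _ * x"] mult_1_right mult_zero_right)
  qed
  also have "\<dots> = (\<Sum>ij\<in>UNIV. cnj (T ij) * cnj (T (prod.swap ij)))"
    by (simp only: sum.delta finite UNIV_I if_True)
  also have "\<dots> = (\<Sum>ij\<in>UNIV. complex_of_real ((norm (T ij))\<^sup>2))"
  proof (intro sum.cong refl)
    fix ij :: "'n \<times> 'n"
    have "cnj (T (prod.swap ij)) = T ij"
      by (simp add: T_def hermitian_part_component add.commute)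
    then show "cnj (T ij) * cnj (T (prod.swap ij)) = complex_of_real ((norm (T ij))\<^sup>2)"
      by (simp only: complex_norm_square mult.commute)
  qed
  also have "\<dots> = complex_of_real ((norm (hermitian_part t))\<^sup>2)"
    by (simp add: norm_matrix_squared sum.cartesian_product T_def case_prod_beta)
  finally have "has_bochner_integral ?P (\<lambda>a. (centred_form t a)\<^sup>2) ((norm (hermitian_part t))\<^sup>2)"
    by (drule_tac has_bochner_integral_Re) (simp only: Re_complex_of_real)
  then show "integrable ?P (\<lambda>a. (centred_form t a)\<^sup>2)"
    and "(\<integral>a. (centred_form t a)\<^sup>2 \<partial>?P) = (norm (hermitian_part t))\<^sup>2"
    by (simp_all only: has_bochner_integral_iff)
qed

lemma inner_centred_gram_matrix:
  "t \<bullet> ((gram_matrix M A - real M *\<^sub>R mat 1) /\<^sub>R sqrt (real M)) =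
    (\<Sum>k<M. centred_form t (\<lambda>i. A (i, k))) / sqrt (real M)"
proof -
  have "gram_matrix M A = (\<Sum>k<M. outer_product (\<lambda>i. A (i, k)))"
    by (simp add: gram_matrix_def outer_product_def vec_eq_iff)
  then have "gram_matrix M A - real M *\<^sub>R mat 1 = (\<Sum>k<M. outer_product (\<lambda>i. A (i, k)) - mat 1)"
    by (simp add: sum_subtractf sum_constant_scaleR del: sum_constant)
  then show ?thesis
    by (simp add: centred_form_def inner_sum_right divide_inverse)
qed

text \<open>One infinite array carries the matrices \<open>A\<close> for all \<open>M\<close> at once: the central limit theorem is
  about the partial sums of a single sequence of random variables.\<close>

abbreviation gaussian_array :: "('n \<times> nat \<Rightarrow> complex) measure" where
  "gaussian_array \<equiv> \<Pi>\<^sub>M ik\<in>UNIV. complex_gaussian"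

lemma distr_gaussian_array_column:
  "distr gaussian_array (\<Pi>\<^sub>M i\<in>UNIV. complex_gaussian) (\<lambda>A i. A (i, k)) = (\<Pi>\<^sub>M i\<in>(UNIV :: 'n::finite set). complex_gaussian)"
  using distr_PiM_reindex[of UNIV "\<lambda>_. complex_gaussian" "\<lambda>i :: 'n. (i, k)" UNIV]
  by (simp add: prob_space_complex_gaussian inj_on_def restrict_UNIV)

text \<open>The coordinates of a product measure are independent, and different columns use disjoint sets of
  coordinates.\<close>

lemma indep_columns:
  "prob_space.indep_vars (gaussian_array :: ('n::finite \<times> nat \<Rightarrow> complex) measure)
    (\<lambda>_. \<Pi>\<^sub>M i\<in>UNIV. complex_gaussian) (\<lambda>k A i. A (i, k)) UNIV"
proof -
  interpret product_prob_space "\<lambda>_ :: 'n \<times> nat. complex_gaussian" UNIV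
    by (rule product_prob_spaceI) (rule prob_space_complex_gaussian)
  have "indep_vars (\<lambda>_. complex_gaussian) (\<lambda>ik A. A ik) (UNIV :: ('n \<times> nat) set)"
    by (subst indep_vars_iff_distr_eq_PiM') (auto simp: PiM_component distr_id2 restrict_UNIV)
  then have "indep_vars (\<lambda>k. \<Pi>\<^sub>M ik\<in>UNIV \<times> {k}. complex_gaussian)
      (\<lambda>k A. restrict (\<lambda>ik. A ik) (UNIV \<times> {k})) (UNIV :: nat set)"
    by (rule indep_vars_restrict) (auto simp: disjoint_family_on_def)
  then have "indep_vars (\<lambda>_. \<Pi>\<^sub>M i\<in>(UNIV :: 'n set). complex_gaussian)
      (\<lambda>k A. (\<lambda>B i. B (i, k)) (restrict (\<lambda>ik. A ik) (UNIV \<times> {k}))) UNIV"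
  proof (rule indep_vars_compose2)
    show "(\<lambda>B i. B (i, k)) \<in> measurable (\<Pi>\<^sub>M ik\<in>(UNIV :: 'n set) \<times> {k}. complex_gaussian) (\<Pi>\<^sub>M i\<in>UNIV. complex_gaussian)" for k
      by (rule measurable_PiM_single') (auto simp: space_PiM)
  qed
  then show ?thesis
    by simp
qed

lemma char_LUE:
  fixes t :: "complex ^ 'n ^ 'n"
  shows "(\<integral>H. iexp (t \<bullet> ((H - real M *\<^sub>R mat 1) /\<^sub>R sqrt (real M))) \<partial>LUE M) =
    (\<integral>A. iexp ((\<Sum>k<M. centred_form t (\<lambda>i. A (i, k))) / sqrt (real M)) \<partial>gaussian_array)"
proof -
  interpret product_prob_space "\<lambda>_ :: 'n \<times> nat. complex_gaussian" UNIV
    by (rule product_prob_spaceI) (rule prob_space_complex_gaussian)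
  let ?J = "(UNIV :: 'n set) \<times> {..<M}"
  let ?h = "\<lambda>H. iexp (t \<bullet> ((H - real M *\<^sub>R mat 1) /\<^sub>R sqrt (real M)))"
  have h: "?h \<in> borel_measurable hermitian_borel"
    by (intro measurable_restrict_space1 borel_measurable_continuous_onI continuous_intros)
  have "integral\<^sup>L (LUE M) ?h = (\<integral>A. ?h (gram_matrix M A) \<partial>(\<Pi>\<^sub>M ik\<in>?J. complex_gaussian))"
    unfolding LUE_def by (rule integral_distr[OF measurable_gram_matrix h])
  also have "(\<Pi>\<^sub>M ik\<in>?J. complex_gaussian) = distr gaussian_array (\<Pi>\<^sub>M ik\<in>?J. complex_gaussian) (\<lambda>A. restrict A ?J)"
    by (rule distr_PiM_restrict_finite[symmetric]) auto
  also have "(\<integral>A. ?h (gram_matrix M A) \<partial>\<dots>) = (\<integral>A. ?h (gram_matrix M (restrict A ?J)) \<partial>gaussian_array)"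
    by (rule integral_distr[OF measurable_restrict_subset measurable_compose[OF measurable_gram_matrix h]]) simp
  also have "\<dots> = (\<integral>A. ?h (gram_matrix M A) \<partial>gaussian_array)"
    by (simp add: gram_matrix_def)
  also have "\<dots> = (\<integral>A. iexp ((\<Sum>k<M. centred_form t (\<lambda>i. A (i, k))) / sqrt (real M)) \<partial>gaussian_array)"
    unfolding inner_centred_gram_matrix ..
  finally show ?thesis .
qed

text \<open>The forms of the columns are independent and identically distributed, with mean 0 and variance
  \<open>\<sigma>\<^sup>2 = \<parallel>T\<parallel>\<^sup>2\<close>. If \<open>\<sigma> > 0\<close>, the central limit theorem for the partial sums divided by \<open>\<sigma> \<surd>M\<close> is
  read off at the point \<open>\<sigma>\<close> of the characteristic function. If \<open>\<sigma> = 0\<close>, that is, if \<open>t\<close> is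
  orthogonal to all Hermitian matrices, the forms vanish almost surely.\<close>

theorem char_LUE_tendsto:
  fixes t :: "complex ^ 'n ^ 'n"
  shows "(\<lambda>M. \<integral>H. iexp (t \<bullet> ((H - real M *\<^sub>R mat 1) /\<^sub>R sqrt (real M))) \<partial>LUE M)
    \<longlonglongrightarrow> exp (- ((norm (hermitian_part t))\<^sup>2 / 2))"
proof -
  let ?P = "gaussian_array :: ('n \<times> nat \<Rightarrow> complex) measure"
  let ?C = "\<Pi>\<^sub>M i\<in>(UNIV :: 'n set). complex_gaussian"
  interpret prob_space ?P
    by (intro prob_space_PiM prob_space_complex_gaussian)
  define \<sigma> where "\<sigma> = norm (hermitian_part t)"
  define X where "X k A = centred_form t (\<lambda>i. A (i, k))" for k and A :: "'n \<times> nat \<Rightarrow> complex"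
  have column: "(\<lambda>A i. A (i, k)) \<in> measurable ?P ?C" for k
    by (rule measurable_PiM_single') (auto simp: space_PiM)
  have X_rv: "X k \<in> borel_measurable ?P" for k
    unfolding X_def by (rule measurable_compose[OF column measurable_centred_form])
  have distr: "distr ?P borel (X k) = distr ?C borel (centred_form t)" for k
  proof -
    have "distr ?C borel (centred_form t) = distr (distr ?P ?C (\<lambda>A i. A (i, k))) borel (centred_form t)"
      by (simp only: distr_gaussian_array_column)
    also have "\<dots> = distr ?P borel (centred_form t \<circ> (\<lambda>A i. A (i, k)))"
      by (rule distr_distr[OF measurable_centred_form column])
    finally show ?thesis
      by (simp only: X_def[abs_def] comp_def)
  qed
  have transfer: "(\<integral>A. f (X k A) \<partial>?P) = (\<integral>a. f (centred_form t a) \<partial>?C)"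
    and transfer_int: "integrable ?P (\<lambda>A. f (X k A)) \<longleftrightarrow> integrable ?C (\<lambda>a. f (centred_form t a))"
    if "f \<in> borel_measurable borel" for f :: "real \<Rightarrow> real" and k
    using integral_distr[OF X_rv that, of k] integral_distr[OF measurable_centred_form that, of t]
      integrable_distr_eq[OF X_rv that, of k] integrable_distr_eq[OF measurable_centred_form that, of t]
    unfolding distr by simp_all
  have mean: "expectation (X k) = 0" for k
    using transfer[of "\<lambda>x. x"] by (simp add: integral_centred_form)
  have sq_int: "integrable ?P (\<lambda>A. (X k A)\<^sup>2)" for k
    by (subst transfer_int) (simp_all add: integrable_centred_form_squared)
  have var: "expectation (\<lambda>A. (X k A)\<^sup>2) = \<sigma>\<^sup>2" for k
    by (subst transfer) (simp_all add: integral_centred_form_squared \<sigma>_def)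
  have lim: "(\<lambda>M. \<integral>A. iexp ((\<Sum>k<M. X k A) / sqrt (real M)) \<partial>?P) \<longlonglongrightarrow> exp (- (\<sigma>\<^sup>2 / 2))"
  proof (cases "\<sigma> = 0")
    case True
    have "AE A in ?P. (X k A)\<^sup>2 = 0" for k
      using integral_nonneg_eq_0_iff_AE[OF sq_int[of k]] var[of k] True by simp
    then have "AE A in ?P. \<forall>k. X k A = 0"
      by (simp add: AE_all_countable)
    then have "(\<integral>A. iexp ((\<Sum>k<M. X k A) / sqrt (real M)) \<partial>?P) = (\<integral>A. 1 \<partial>?P)" for M
      using X_rv by (intro integral_cong_AE) auto
    then show ?thesis
      using True by (simp add: prob_space)
  next
    case False
    then have "0 < \<sigma>" by (simp add: \<sigma>_def)
    have "indep_vars (\<lambda>_. borel) X UNIV"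
      using indep_vars_compose2[OF indep_columns, of "\<lambda>_. centred_form t" "\<lambda>_. borel"] measurable_centred_form
      unfolding X_def by blast
    then have "weak_conv_m (\<lambda>M. distr ?P borel (\<lambda>A. (\<Sum>k<M. X k A) / sqrt (real M * \<sigma>\<^sup>2))) std_normal_distribution"
      by (rule central_limit_theorem_zero_mean[OF _ mean \<open>0 < \<sigma>\<close> sq_int _ distr]) (simp add: mean var)
    then have "(\<lambda>M. char (distr ?P borel (\<lambda>A. (\<Sum>k<M. X k A) / sqrt (real M * \<sigma>\<^sup>2))) \<sigma>)
        \<longlonglongrightarrow> char std_normal_distribution \<sigma>"
      using X_rv by (intro levy_continuity1 real_dist_normal_dist real_distribution_distr) auto
    moreover have "char (distr ?P borel (\<lambda>A. (\<Sum>k<M. X k A) / sqrt (real M * \<sigma>\<^sup>2))) \<sigma> =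
        (\<integral>A. iexp ((\<Sum>k<M. X k A) / sqrt (real M)) \<partial>?P)" for M
    proof -
      have "\<sigma> * (s / sqrt (real M * \<sigma>\<^sup>2)) = s / sqrt (real M)" for s
        using \<open>0 < \<sigma>\<close> by (simp add: real_sqrt_mult)
      then show ?thesis
        unfolding char_def using X_rv
        by (subst integral_distr) (auto simp del: of_real_mult of_real_divide simp flip: of_real_mult)
    qed
    ultimately show ?thesis
      by (simp add: char_std_normal_distribution)
  qed
  then show ?thesis
    unfolding char_LUE X_def \<sigma>_def .
qed

section \<open>Convergence in distribution\<close>

lemma hermitian_matrices_iff: "H \<in> hermitian_matrices \<longleftrightarrow> (\<forall>i j. cnj (H $ j $ i) = H $ i $ j)"
  by (simp add: hermitian_matrices_def ctranspose_def vec_eq_iff)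

lemma hermitian_part_in_hermitian_matrices: "hermitian_part A \<in> hermitian_matrices"
  by (simp add: hermitian_matrices_iff hermitian_part_component add.commute)

lemma hermitian_part_eq: "H \<in> hermitian_matrices \<Longrightarrow> hermitian_part H = H"
  by (simp add: hermitian_matrices_iff vec_eq_iff hermitian_part_component)

lemma continuous_on_hermitian_part: "continuous_on S hermitian_part"
  unfolding hermitian_part_def by (intro continuous_intros) auto

definition normalised :: "nat \<Rightarrow> complex ^ 'n ^ 'n \<Rightarrow> complex ^ 'n ^ 'n" where
  "normalised M H = (H - real M *\<^sub>R mat 1) /\<^sub>R sqrt (real M)"

lemma normalised_in_hermitian_matrices:
  "H \<in> hermitian_matrices \<Longrightarrow> normalised M H \<in> hermitian_matrices"
  by (simp add: normalised_def hermitian_matrices_iff mat_def)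

lemma measurable_normalised: "normalised M \<in> hermitian_borel \<rightarrow>\<^sub>M hermitian_borel"
proof (rule measurable_restrict_space2)
  show "normalised M \<in> space hermitian_borel \<rightarrow> hermitian_matrices"
    using normalised_in_hermitian_matrices by (auto simp: space_restrict_space)
  show "normalised M \<in> hermitian_borel \<rightarrow>\<^sub>M borel"
    unfolding normalised_def[abs_def]
    by (intro measurable_restrict_space1 borel_measurable_continuous_onI continuous_intros)
qed

lemma sets_LUE: "sets (LUE M) = sets hermitian_borel"
  by (simp add: LUE_def)

lemma sets_GUE: "sets GUE = sets hermitian_borel"
  by (simp add: GUE_def)

text \<open>The continuity theorem is about test functions on a whole Euclidean space. A function on the
  Hermitian matrices is extended to all matrices by composing it with the projection onto the
  Hermitian part, which is continuous and fixes every Hermitian matrix.\<close>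

lemma integral_normalised_LUE_tendsto:
  fixes f :: "complex ^ ('n :: {finite, linorder}) ^ ('n :: {finite, linorder}) \<Rightarrow> real"
  assumes f: "continuous_on hermitian_matrices f" "bounded (f ` hermitian_matrices)"
  shows "(\<lambda>M. \<integral>H. f (normalised M H) \<partial>LUE M) \<longlonglongrightarrow> (\<integral>H. f H \<partial>GUE)"
proof -
  define F where "F A = f (hermitian_part A)" for A
  have F_cont: "continuous_on UNIV F"
    unfolding F_def
    by (rule continuous_on_compose2[OF f(1) continuous_on_hermitian_part])
       (auto simp: hermitian_part_in_hermitian_matrices)
  have F_bounded: "bounded (range F)"
    by (rule bounded_subset[OF f(2)]) (auto simp: F_def hermitian_part_in_hermitian_matrices)
  have F_eq: "F H = f H" if "H \<in> hermitian_matrices" for H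
    using hermitian_part_eq[OF that] by (simp add: F_def)
  have F_meas: "F \<in> borel_measurable borel"
    by (rule borel_measurable_continuous_onI) (rule F_cont)
  have id_meas: "(\<lambda>H. H) \<in> GUE \<rightarrow>\<^sub>M (borel :: ((complex, 'n) vec, 'n) vec measure)"
    unfolding measurable_cong_sets[OF sets_GUE refl] by (rule measurable_restrict_space1) simp
  have Z_meas: "normalised M \<in> LUE M \<rightarrow>\<^sub>M (borel :: ((complex, 'n) vec, 'n) vec measure)" for M
    unfolding measurable_cong_sets[OF sets_LUE refl]
    by (rule measurable_compose[OF measurable_normalised measurable_restrict_space1[OF measurable_ident_sets[OF refl]]])
  define \<mu> where "\<mu> M = distr (LUE M) (borel :: ((complex, 'n) vec, 'n) vec measure) (normalised M)" for M
  define \<nu> where "\<nu> = distr GUE (borel :: ((complex, 'n) vec, 'n) vec measure) (\<lambda>H. H)"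
  have \<mu>: "prob_space (\<mu> M)" "sets (\<mu> M) = sets borel" for M
    unfolding \<mu>_def by (simp_all add: prob_space.prob_space_distr[OF prob_space_LUE Z_meas])
  have \<nu>: "prob_space \<nu>" "sets \<nu> = sets borel"
    unfolding \<nu>_def by (simp_all add: prob_space.prob_space_distr[OF prob_space_GUE id_meas])
  have "(\<lambda>M. integral\<^sup>L (\<mu> M) F) \<longlonglongrightarrow> integral\<^sup>L \<nu> F"
  proof (rule levy_continuity_euclidean[OF \<mu> \<nu> _ F_cont F_bounded])
    fix t :: "((complex, 'n) vec, 'n) vec"
    have iexp: "(\<lambda>H. iexp (t \<bullet> H)) \<in> borel_measurable borel"
      by (intro borel_measurable_continuous_onI continuous_intros)
    show "(\<lambda>M. \<integral>H. iexp (t \<bullet> H) \<partial>\<mu> M) \<longlonglongrightarrow> (\<integral>H. iexp (t \<bullet> H) \<partial>\<nu>)"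
      unfolding \<mu>_def \<nu>_def integral_distr[OF Z_meas iexp] integral_distr[OF id_meas iexp] char_GUE
      unfolding normalised_def by (rule char_LUE_tendsto)
  qed
  also have "integral\<^sup>L \<nu> F = (\<integral>H. f H \<partial>GUE)"
    unfolding \<nu>_def integral_distr[OF id_meas F_meas]
    by (intro Bochner_Integration.integral_cong refl F_eq)
       (simp add: sets_eq_imp_space_eq[OF sets_GUE] space_restrict_space)
  also have "(\<lambda>M. integral\<^sup>L (\<mu> M) F) = (\<lambda>M. \<integral>H. f (normalised M H) \<partial>LUE M)"
    unfolding \<mu>_def integral_distr[OF Z_meas F_meas]
    by (intro ext Bochner_Integration.integral_cong refl F_eq normalised_in_hermitian_matrices)
       (simp add: sets_eq_imp_space_eq[OF sets_LUE] space_restrict_space)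
  finally show ?thesis .
qed

text \<open>The integrals depend on the random matrices only through their laws. The hypotheses on
  \<open>Y M\<close> hold for \<open>M \<ge> N\<close>, hence for almost all \<open>M\<close>.\<close>

theorem theorem2p1:
  fixes X :: "'a \<Rightarrow> complex ^ ('n :: {finite, linorder}) ^ ('n :: {finite, linorder})"
    and Y :: "nat \<Rightarrow> 'b \<Rightarrow> complex ^ ('n :: {finite, linorder}) ^ ('n :: {finite, linorder})"
    and P :: "'a measure" and Q :: "nat \<Rightarrow> 'b measure"
  assumes "prob_space P"
    and "X \<in> P \<rightarrow>\<^sub>M hermitian_borel"
    and "distr P hermitian_borel X = GUE"
    and "\<And>M. M \<ge> CARD('n) \<Longrightarrow> prob_space (Q M)"
    and "\<And>M. M \<ge> CARD('n) \<Longrightarrow> Y M \<in> Q M \<rightarrow>\<^sub>M hermitian_borel"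
    and "\<And>M. M \<ge> CARD('n) \<Longrightarrow> distr (Q M) hermitian_borel (Y M) = LUE M"
  shows "converges_in_distribution hermitian_matrices
           Q (\<lambda>M \<omega>. (Y M \<omega> - real M *\<^sub>R mat 1) /\<^sub>R sqrt (real M)) P X"
  unfolding converges_in_distribution_def
proof (intro allI impI)
  fix f :: "((complex, 'n) vec, 'n) vec \<Rightarrow> real"
  assume f: "continuous_on hermitian_matrices f" "bounded (f ` hermitian_matrices)"
  have f_meas: "f \<in> borel_measurable hermitian_borel"
    using f(1) by (rule borel_measurable_continuous_on_restrict)
  have X: "(\<integral>H. f H \<partial>GUE) = (\<integral>\<omega>. f (X \<omega>) \<partial>P)"
    unfolding assms(3)[symmetric] by (rule integral_distr[OF assms(2) f_meas])
  have Y: "(\<integral>H. f (normalised M H) \<partial>LUE M) = (\<integral>\<omega>. f (normalised M (Y M \<omega>)) \<partial>Q M)"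
    if "M \<ge> CARD('n)" for M
    unfolding assms(6)[OF that, symmetric]
    by (rule integral_distr[OF assms(5)[OF that] measurable_compose[OF measurable_normalised f_meas]])
  have "\<forall>\<^sub>F M in sequentially.
      (\<integral>H. f (normalised M H) \<partial>LUE M) = (\<integral>\<omega>. f (normalised M (Y M \<omega>)) \<partial>Q M)"
    using Y by (rule eventually_sequentiallyI)
  with integral_normalised_LUE_tendsto[OF f]
  have "(\<lambda>M. \<integral>\<omega>. f (normalised M (Y M \<omega>)) \<partial>Q M) \<longlonglongrightarrow> (\<integral>H. f H \<partial>GUE)"
    by (rule Lim_transform_eventually)
  then show "(\<lambda>M. \<integral>\<omega>. f ((Y M \<omega> - real M *\<^sub>R mat 1) /\<^sub>R sqrt (real M)) \<partial>Q M)
      \<longlonglongrightarrow> (\<integral>\<omega>. f (X \<omega>) \<partial>P)"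
    unfolding X normalised_def .
qed

end
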